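(* For all $X\subseteq\mathbf C$, $\dim_{\#\mathrm P}(X)\le\mathcal K_{\mathrm{poly}}(X)$ and $\mathrm{Dim}_{\#\mathrm P}(X)\le\mathcal K^{\mathrm{str}}_{\mathrm{poly}}(X)$.
   Context: $\mathbf C=\{0,1\}^\infty$; $S\upharpoonright n$ is the length-$n$ prefix of $S$. For a time bound $t$, $K^t(x)$ is the length of the shortest program that makes a fixed universal Turing machine print $x$ within $t(|x|)$ steps. $\mathcal K_{\mathrm{poly}}(X)=\inf_{p}\sup_{S\in X}\liminf_{n\to\infty}\frac{K^p(S\upharpoonright n)}{n}$ and $\mathcal K^{\mathrm{str}}_{\mathrm{poly}}(X)=\inf_p\sup_{S\in X}\limsup_{n\to\infty}\frac{K^p(S\upharpoonright n)}{n}$, the infima over polynomials $p$. A martingale is $d:\{0,1\}^*\to[0,\infty)$ with $d(w)=\frac{d(w0)+d(w1)}{2}$; for $s>0$, it $s$-succeeds on $S$ if $d(S\upharpoonright n)\ge2^{(1-s)n}$ for infinitely many $n$, and $s$-strongly succeeds if for all but finitely many $n$. A #P function counts accepting paths of a fixed polynomial-time nondeterministic Turing machine; a #P-martingale is a martingale $d$ for which there are a #P function $f$ and polynomial-time computable $g$ with power-of-2 values such that $|d(w)-f(w,r)/g(w,r)|\le2^{-r}$ for all $w$ and $r\in\mathbb N$ ($r$ in unary). $\dim_{\#\mathrm P}(X)$ (resp. $\mathrm{Dim}_{\#\mathrm P}(X)$) is the infimum of $s$ such that some #P-martingale $s$-succeeds (resp. $s$-strongly succeeds) on every element of $X$. 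*)

theory Defs
  imports
    Complex_Main
    "HOL-Library.Extended_Nonnegative_Real"
    "HOL-Computational_Algebra.Polynomial"
begin

section \<open>Multi-tape Turing machines\<close>

text \<open>
  A machine is given by a finite set of transition rules, so that its state set and its tape
  alphabet are finite. Tapes are two-way infinite. A configuration is halting if no rule applies
  to it. Deterministic machines are the special case in which at most one rule applies.
\<close>

datatype symbol = Blank | Bit bool | Mark nat

datatype move = MoveL | Stay | MoveR

fun offset :: "move \<Rightarrow> int" where
  "offset MoveL = -1"
| "offset Stay = 0"
| "offset MoveR = 1"

text \<open>A tape is its content together with the position of the head.\<close>
type_synonym tape = "(int \<Rightarrow> symbol) \<times> int"

type_synonym config = "nat \<times> tape list"

datatype rule =
  Rule (src: nat) (reads: "symbol list") (dst: nat) (acts: "(symbol \<times> move) list")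

record tm =
  tapes :: nat
  start :: nat
  accept :: nat
  rules :: "rule set"

definition turing_machine :: "tm \<Rightarrow> bool" where
  "turing_machine M \<longleftrightarrow> tapes M \<ge> 1 \<and> finite (rules M) \<and>
     (\<forall>\<rho>\<in>rules M. length (reads \<rho>) = tapes M \<and> length (acts \<rho>) = tapes M)"

definition deterministic :: "tm \<Rightarrow> bool" where
  "deterministic M \<longleftrightarrow>
     (\<forall>\<rho>\<in>rules M. \<forall>\<sigma>\<in>rules M. src \<rho> = src \<sigma> \<and> reads \<rho> = reads \<sigma> \<longrightarrow> \<rho> = \<sigma>)"

definition head_symbol :: "tape \<Rightarrow> symbol" where
  "head_symbol T = fst T (snd T)"

fun act :: "symbol \<times> move \<Rightarrow> tape \<Rightarrow> tape" where
  "act (a, m) (c, i) = (c(i := a), i + offset m)"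

definition enabled :: "tm \<Rightarrow> config \<Rightarrow> rule set" where
  "enabled M c = {\<rho> \<in> rules M. src \<rho> = fst c \<and> reads \<rho> = map head_symbol (snd c)}"

definition fire :: "rule \<Rightarrow> config \<Rightarrow> config" where
  "fire \<rho> c = (dst \<rho>, map2 act (acts \<rho>) (snd c))"

text \<open>
  A computation path is recorded as the list of the rules applied. On two-way infinite tapes
  distinct enabled rules lead to distinct configurations, so this is the same as recording the
  configurations.
\<close>
fun path :: "tm \<Rightarrow> config \<Rightarrow> rule list \<Rightarrow> bool" where
  "path M c [] \<longleftrightarrow> True"
| "path M c (\<rho> # \<rho>s) \<longleftrightarrow> \<rho> \<in> enabled M c \<and> path M (fire \<rho> c) \<rho>s"

definition halting_path :: "tm \<Rightarrow> config \<Rightarrow> rule list \<Rightarrow> bool" where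
  "halting_path M c \<rho>s \<longleftrightarrow> path M c \<rho>s \<and> enabled M (fold fire \<rho>s c) = {}"

definition accepting_path :: "tm \<Rightarrow> config \<Rightarrow> rule list \<Rightarrow> bool" where
  "accepting_path M c \<rho>s \<longleftrightarrow> halting_path M c \<rho>s \<and> fst (fold fire \<rho>s c) = accept M"

definition blank_tape :: tape where
  "blank_tape = (\<lambda>_. Blank, 0)"

definition input_tape :: "bool list \<Rightarrow> tape" where
  "input_tape x = (\<lambda>i. if 0 \<le> i \<and> i < int (length x) then Bit (x ! nat i) else Blank, 0)"

definition initial :: "tm \<Rightarrow> bool list \<Rightarrow> config" where
  "initial M x = (start M, input_tape x # replicate (tapes M - 1) blank_tape)"

text \<open>The string written on a tape extends from cell 0 up to the first blank.\<close>
definition tape_shows :: "tape \<Rightarrow> bool list \<Rightarrow> bool" where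
  "tape_shows T x \<longleftrightarrow>
     (\<forall>i<length x. fst T (int i) = Bit (x ! i)) \<and> fst T (int (length x)) = Blank"

text \<open>
  On input \<open>x\<close>, the machine halts within \<open>t\<close> steps with output \<open>y\<close>. The first tape is the input
  tape and the last tape is the output tape.
\<close>
definition prints :: "tm \<Rightarrow> bool list \<Rightarrow> bool list \<Rightarrow> nat \<Rightarrow> bool" where
  "prints M x y t \<longleftrightarrow>
     (\<exists>\<rho>s. halting_path M (initial M x) \<rho>s \<and> length \<rho>s \<le> t \<and>
       tape_shows (last (snd (fold fire \<rho>s (initial M x)))) y)"

text \<open>
  Every deterministic machine \<open>M\<close> has a code \<open>e\<close> such that the universal machine computes on
  \<open>e @ \<pi>\<close> the same partial function as \<open>M\<close> on \<open>\<pi>\<close>, with polynomial overhead in time and constant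
  overhead in program length.
\<close>
definition universal :: "tm \<Rightarrow> bool" where
  "universal U \<longleftrightarrow> turing_machine U \<and> deterministic U \<and>
     (\<forall>M. turing_machine M \<and> deterministic M \<longrightarrow>
       (\<exists>e. \<exists>q :: nat poly. \<forall>\<pi> x.
         (\<forall>t. prints M \<pi> x t \<longrightarrow> prints U (e @ \<pi>) x (poly q (length \<pi> + t))) \<and>
         ((\<exists>t. prints U (e @ \<pi>) x t) \<longrightarrow> (\<exists>t. prints M \<pi> x t))))"


section \<open>Time-bounded Kolmogorov complexity\<close>

definition prefix :: "(nat \<Rightarrow> bool) \<Rightarrow> nat \<Rightarrow> bool list" (infix "\<restriction>" 100) where
  "S \<restriction> n = map S [0..<n]"

text \<open>The value is infinite if no program prints \<open>x\<close> within the time bound.\<close>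
definition K :: "tm \<Rightarrow> (nat \<Rightarrow> nat) \<Rightarrow> bool list \<Rightarrow> enat" where
  "K U t x = (INF \<pi>\<in>{\<pi>. prints U \<pi> x (t (length x))}. enat (length \<pi>))"

text \<open>Suprema and infima are taken in \<open>[0, \<infinity>]\<close>; in particular the supremum over the empty set is 0.\<close>
definition K_poly :: "tm \<Rightarrow> (nat \<Rightarrow> bool) set \<Rightarrow> ennreal" where
  "K_poly U X =
     (INF p :: nat poly. SUP S\<in>X. liminf (\<lambda>n. ennreal_of_enat (K U (poly p) (S \<restriction> n)) / of_nat n))"

definition K_str_poly :: "tm \<Rightarrow> (nat \<Rightarrow> bool) set \<Rightarrow> ennreal" where
  "K_str_poly U X =
     (INF p :: nat poly. SUP S\<in>X. limsup (\<lambda>n. ennreal_of_enat (K U (poly p) (S \<restriction> n)) / of_nat n))"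


section \<open>Counting classes\<close>

definition sharpP :: "(bool list \<Rightarrow> nat) \<Rightarrow> bool" where
  "sharpP f \<longleftrightarrow>
     (\<exists>M. \<exists>p :: nat poly. turing_machine M \<and>
       (\<forall>x \<rho>s. path M (initial M x) \<rho>s \<longrightarrow> length \<rho>s \<le> poly p (length x)) \<and>
       (\<forall>x. f x = card {\<rho>s. accepting_path M (initial M x) \<rho>s}))"

text \<open>Natural numbers are output in binary, most significant bit first.\<close>
definition polytime_computable :: "(bool list \<Rightarrow> nat) \<Rightarrow> bool" where
  "polytime_computable g \<longleftrightarrow>
     (\<exists>M. \<exists>p :: nat poly. turing_machine M \<and> deterministic M \<and>
       (\<forall>x. \<exists>y. prints M x y (poly p (length x)) \<and> g x = horner_sum of_bool 2 (rev y)))"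

text \<open>The string \<open>1\<^sup>r0w\<close> encodes the pair of \<open>w\<close> and \<open>r\<close>, with \<open>r\<close> in unary.\<close>
definition enc :: "bool list \<Rightarrow> nat \<Rightarrow> bool list" where
  "enc w r = replicate r True @ False # w"


section \<open>Martingales and dimension\<close>

definition martingale :: "(bool list \<Rightarrow> real) \<Rightarrow> bool" where
  "martingale d \<longleftrightarrow> (\<forall>w. 0 \<le> d w \<and> d w = (d (w @ [False]) + d (w @ [True])) / 2)"

definition sharpP_martingale :: "(bool list \<Rightarrow> real) \<Rightarrow> bool" where
  "sharpP_martingale d \<longleftrightarrow> martingale d \<and>
     (\<exists>f g. sharpP f \<and> polytime_computable g \<and>
       (\<forall>w r. \<exists>k::nat. g (enc w r) = 2 ^ k) \<and>
       (\<forall>w r. \<bar>d w - real (f (enc w r)) / real (g (enc w r))\<bar> \<le> 1 / 2 ^ r))"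

definition succeeds :: "real \<Rightarrow> (bool list \<Rightarrow> real) \<Rightarrow> (nat \<Rightarrow> bool) \<Rightarrow> bool" where
  "succeeds s d S \<longleftrightarrow> (\<exists>\<^sub>F n in sequentially. d (S \<restriction> n) \<ge> 2 powr ((1 - s) * real n))"

definition strongly_succeeds :: "real \<Rightarrow> (bool list \<Rightarrow> real) \<Rightarrow> (nat \<Rightarrow> bool) \<Rightarrow> bool" where
  "strongly_succeeds s d S \<longleftrightarrow> (\<forall>\<^sub>F n in sequentially. d (S \<restriction> n) \<ge> 2 powr ((1 - s) * real n))"

definition dim_sharpP :: "(nat \<Rightarrow> bool) set \<Rightarrow> ennreal" where
  "dim_sharpP X =
     (INF s\<in>{s. 0 < s \<and> (\<exists>d. sharpP_martingale d \<and> (\<forall>S\<in>X. succeeds s d S))}. ennreal s)"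

definition Dim_sharpP :: "(nat \<Rightarrow> bool) set \<Rightarrow> ennreal" where
  "Dim_sharpP X =
     (INF s\<in>{s. 0 < s \<and> (\<exists>d. sharpP_martingale d \<and> (\<forall>S\<in>X. strongly_succeeds s d S))}. ennreal s)"

end

theory Submission
  imports Defs "HOL-Library.Countable"
begin

text \<open>
  Fix a polynomial time bound and a large constant \<open>k\<close>. A random experiment writes a program \<open>\<pi>\<close> for
  the universal machine in \<open>m\<close> random rounds, each of which appends \<open>k\<close> bits, one bit or nothing and
  continues with probability 1/2. The machine then runs on \<open>\<pi>\<close> for \<open>(m + 2)\<^sup>j - 1\<close> steps, and every
  cell of its output tape that does not carry a bit is filled with a fair coin. If \<open>\<mu> w\<close> is the
  probability that the resulting sequence begins with \<open>w\<close>, then \<open>d w = 2\<^bsup>|w|\<^esup> \<mu> w\<close> is a martingale.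
  A string of length \<open>n\<close> printed in polynomial time by a program of length \<open>l\<close> has
  \<open>\<mu> x \<ge> 2\<^bsup>-l - O((l + n)/k) - O(k)\<^esup>\<close>, because full blocks cost \<open>k + 2\<close> coin flips each and only
  boundedly many bits need to be written singly; letting \<open>k\<close> grow gives both inequalities.

  The experiment restricted to fewer than \<open>L = r + 1 + |w|\<close> rounds misses mass at most \<open>2\<^bsup>-L\<^esup>\<close>, and is
  carried out by a nondeterministic machine that scans its input \<open>1\<^sup>r0w\<close>, one round per cell.
\<close>

text \<open>For \<open>d\<close> to be a martingale, one measure has to serve all lengths of
  \<open>w\<close>, so the running time granted to the universal machine cannot be read off from
  \<open>w\<close>. It is bought inside the experiment instead: rounds that append nothing serve
  only to raise \<open>m\<close>, and about n/k of them make the clock outlast a given polynomial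
  p(n), since a power \<open>(m + 2) ^ j\<close> absorbs every constant. They cost O(n/k) flips,
  which is negligible against n once k is large. The coins in cells without a bit have a similar
  purpose: a program that prints only finitely many bits must still pass on all its weight to longer
  strings, or \<open>d w\<close> would exceed the average over its two successors. A machine can
  count the result because \<open>2 ^ length w\<close> times a probability is a product of factors
  2, 1 or 0, one for each bit of \<open>w\<close>, while all flips share one denominator that
  depends only on the input length: cells after the end of the experiment still branch, without
  effect. The clock also bounds the simulation on every path, as U may diverge on a guessed
  program.\<close>

section \<open>Counting accepting paths\<close>

text \<open>The bound covers unfinished and rejecting paths too, as \<open>sharpP\<close> demands.
  Finiteness is stated separately because \<open>card\<close> of an infinite set is 0.\<close>

definition path_count :: "tm \<Rightarrow> config \<Rightarrow> nat \<Rightarrow> nat \<Rightarrow> bool" where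
  "path_count M c T v \<longleftrightarrow>
     (\<forall>\<rho>s. path M c \<rho>s \<longrightarrow> length \<rho>s \<le> T) \<and>
     finite {\<rho>s. accepting_path M c \<rho>s} \<and> card {\<rho>s. accepting_path M c \<rho>s} = v"

lemma path_count_mono: "path_count M c T v \<Longrightarrow> T \<le> T' \<Longrightarrow> path_count M c T' v"
  unfolding path_count_def by fastforce

lemma path_count_halt:
  assumes "enabled M c = {}"
  shows "path_count M c T (of_bool (fst c = accept M))"
proof -
  have *: "path M c \<rho>s \<longleftrightarrow> \<rho>s = []" for \<rho>s
    using assms by (cases \<rho>s) auto
  then have "{\<rho>s. accepting_path M c \<rho>s} = (if fst c = accept M then {[]} else {})"
    using assms by (auto simp: accepting_path_def halting_path_def)
  with * show ?thesis
    by (auto simp: path_count_def)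
qed

text \<open>Lists with different first rules are different, so the counts of the successors add up.
  The assumption \<open>ne\<close> excludes the empty path, which is halting only where no rule
  applies.\<close>

lemma path_count_step:
  assumes ne: "enabled M c \<noteq> {}" and fin: "finite (enabled M c)"
    and step: "\<And>\<rho>. \<rho> \<in> enabled M c \<Longrightarrow> path_count M (fire \<rho> c) T (v \<rho>)"
  shows "path_count M c (Suc T) (\<Sum>\<rho>\<in>enabled M c. v \<rho>)"
proof -
  let ?A = "\<lambda>c. {\<rho>s. accepting_path M c \<rho>s}"
  have eq: "?A c = (\<Union>\<rho>\<in>enabled M c. (#) \<rho> ` ?A (fire \<rho> c))"
  proof (rule set_eqI)
    fix \<rho>s
    show "\<rho>s \<in> ?A c \<longleftrightarrow> \<rho>s \<in> (\<Union>\<rho>\<in>enabled M c. (#) \<rho> ` ?A (fire \<rho> c))"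
      using ne by (cases \<rho>s) (auto simp: accepting_path_def halting_path_def)
  qed
  have finA: "finite (?A (fire \<rho> c))" and cardA: "card (?A (fire \<rho> c)) = v \<rho>"
    if "\<rho> \<in> enabled M c" for \<rho>
    using step[OF that] by (auto simp: path_count_def)
  have "card (?A c) = (\<Sum>\<rho>\<in>enabled M c. card ((#) \<rho> ` ?A (fire \<rho> c)))"
    unfolding eq by (rule card_UN_disjoint) (use fin finA in auto)
  also have "\<dots> = (\<Sum>\<rho>\<in>enabled M c. v \<rho>)"
    by (intro sum.cong refl) (simp add: card_image cardA)
  finally have card: "card (?A c) = (\<Sum>\<rho>\<in>enabled M c. v \<rho>)" .
  have "finite (?A c)"
    unfolding eq using fin finA by auto
  moreover have "length \<rho>s \<le> Suc T" if "path M c \<rho>s" for \<rho>s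
    using that step by (cases \<rho>s) (auto simp: path_count_def)
  ultimately show ?thesis
    using card by (auto simp: path_count_def)
qed

section \<open>Machines given by a transition function on a countable state type\<close>

locale finite_control =
  fixes num :: nat and Q :: "'s::countable set" and \<Gamma> :: "symbol set"
    and \<delta> :: "'s \<Rightarrow> symbol list \<Rightarrow> ('s \<times> (symbol \<times> move) list) set"
    and init final :: 's
  assumes num: "num \<ge> 1"
    and finite_Q: "finite Q" and finite_\<Gamma>: "finite \<Gamma>"
    and finite_\<delta>: "\<And>q rs. finite (\<delta> q rs)"
    and closed_Q: "\<And>q rs q' as. \<lbrakk>q \<in> Q; set rs \<subseteq> \<Gamma>; length rs = num; (q', as) \<in> \<delta> q rs\<rbrakk> \<Longrightarrow> q' \<in> Q"
    and closed_acts: "\<And>q rs q' as. \<lbrakk>q \<in> Q; set rs \<subseteq> \<Gamma>; length rs = num; (q', as) \<in> \<delta> q rs\<rbrakk> \<Longrightarrow>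
      length as = num \<and> fst ` set as \<subseteq> \<Gamma>"
    and init: "init \<in> Q"
    and base: "Blank \<in> \<Gamma>" "\<And>b. Bit b \<in> \<Gamma>"
begin

text \<open>A machine needs finitely many rules with numbered states, whereas
  \<open>\<delta>\<close> lives on infinite types. Restricting it to \<open>Q\<close> and
  \<open>\<Gamma>\<close> gives finiteness, and \<open>to_nat\<close> gives the numbers.\<close>

definition M :: tm where
  "M = \<lparr>tapes = num, start = to_nat init, accept = to_nat final,
        rules = (\<Union>q\<in>Q. \<Union>rs\<in>{rs. set rs \<subseteq> \<Gamma> \<and> length rs = num}.
          (\<lambda>(q', as). Rule (to_nat q) rs (to_nat q') as) ` \<delta> q rs)\<rparr>"

lemma turing_machine_M: "turing_machine M"
proof -
  have "finite (rules M)"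
    by (auto simp: M_def finite_Q finite_\<Gamma> finite_\<delta> finite_lists_length_eq)
  then show ?thesis
    using num closed_acts by (auto simp: turing_machine_def M_def)
qed

lemma deterministic_M:
  assumes "\<And>q rs x y. x \<in> \<delta> q rs \<Longrightarrow> y \<in> \<delta> q rs \<Longrightarrow> x = y"
  shows "deterministic M"
proof -
  have "\<rho> = \<sigma>" if mem: "\<rho> \<in> rules M" "\<sigma> \<in> rules M" and eq: "src \<rho> = src \<sigma>" "reads \<rho> = reads \<sigma>" for \<rho> \<sigma>
  proof -
    obtain p rs p' as where 1: "\<rho> = Rule (to_nat p) rs (to_nat p') as" "(p', as) \<in> \<delta> p rs"
      using mem(1) unfolding M_def by auto
    obtain q rs' q' as' where 2: "\<sigma> = Rule (to_nat q) rs' (to_nat q') as'" "(q', as') \<in> \<delta> q rs'"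
      using mem(2) unfolding M_def by auto
    have "p = q" "rs = rs'"
      using eq 1(1) 2(1) by auto
    with assms 1 2 show ?thesis
      by blast
  qed
  then show ?thesis
    by (auto simp: deterministic_def)
qed

text \<open>The invariant under which the rules of \<open>M\<close> agree with
  \<open>\<delta>\<close>: outside \<open>Q\<close> and \<open>\<Gamma>\<close> the machine has no
  rules.\<close>

definition good :: "'s \<Rightarrow> tape list \<Rightarrow> bool" where
  "good q ts \<longleftrightarrow> q \<in> Q \<and> length ts = num \<and> (\<forall>T\<in>set ts. range (fst T) \<subseteq> \<Gamma>)"

lemma good_heads: "good q ts \<Longrightarrow> set (map head_symbol ts) \<subseteq> \<Gamma>"
  unfolding good_def head_symbol_def by (auto simp: image_subset_iff)

lemma enabled_M:
  assumes "good q ts"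
  shows "enabled M (to_nat q, ts) =
    (\<lambda>(q', as). Rule (to_nat q) (map head_symbol ts) (to_nat q') as) ` \<delta> q (map head_symbol ts)"
  (is "_ = ?r ` _")
proof -
  have "q \<in> Q" "set (map head_symbol ts) \<subseteq> \<Gamma>" "length (map head_symbol ts) = num"
    using assms good_heads[OF assms] by (auto simp: good_def)
  then have sub: "?r ` \<delta> q (map head_symbol ts) \<subseteq> rules M"
    unfolding M_def tm.select_convs by blast
  show ?thesis
  proof (intro subset_antisym subsetI)
    fix \<rho> assume "\<rho> \<in> enabled M (to_nat q, ts)"
    then have \<rho>: "\<rho> \<in> rules M" "src \<rho> = to_nat q" "reads \<rho> = map head_symbol ts"
      by (auto simp: enabled_def)
    then obtain p rs q' as where "\<rho> = Rule (to_nat p) rs (to_nat q') as" "(q', as) \<in> \<delta> p rs"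
      unfolding M_def by auto
    with \<rho> show "\<rho> \<in> ?r ` \<delta> q (map head_symbol ts)"
      by force
  next
    fix \<rho> assume "\<rho> \<in> ?r ` \<delta> q (map head_symbol ts)"
    then show "\<rho> \<in> enabled M (to_nat q, ts)"
      using sub by (auto simp: enabled_def)
  qed
qed

lemma good_step:
  assumes "good q ts" "(q', as) \<in> \<delta> q (map head_symbol ts)"
  shows "good q' (map2 act as ts)"
proof -
  have h: "q \<in> Q" "set (map head_symbol ts) \<subseteq> \<Gamma>" "length (map head_symbol ts) = num"
    using assms(1) good_heads[OF assms(1)] by (auto simp: good_def)
  have q': "q' \<in> Q" and as: "length as = num" "fst ` set as \<subseteq> \<Gamma>"
    using closed_Q[OF h assms(2)] closed_acts[OF h assms(2)] by auto
  have "range (fst (act a T)) \<subseteq> \<Gamma>" if "(a, T) \<in> set (zip as ts)" for a T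
  proof -
    have "fst a \<in> \<Gamma>" "range (fst T) \<subseteq> \<Gamma>"
      using set_zip_leftD[OF that] set_zip_rightD[OF that] as(2) assms(1) unfolding good_def by blast+
    then show ?thesis
      by (cases a; cases T) auto
  qed
  then have "\<forall>T\<in>set (map2 act as ts). range (fst T) \<subseteq> \<Gamma>"
    unfolding set_map by (metis (no_types, lifting) case_prod_conv imageE surj_pair)
  with q' as assms(1) show ?thesis
    by (simp add: good_def)
qed

text \<open>Vacuously true of ill-formed configurations, which spares the rules below all side conditions.\<close>
definition counts :: "'s \<Rightarrow> tape list \<Rightarrow> nat \<Rightarrow> nat \<Rightarrow> bool" where
  "counts q ts T v \<longleftrightarrow> (good q ts \<longrightarrow> path_count M (to_nat q, ts) T v)"

lemma counts_mono: "counts q ts T v \<Longrightarrow> T \<le> T' \<Longrightarrow> counts q ts T' v"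
  using path_count_mono by (auto simp: counts_def)

lemma counts_halt:
  assumes "\<delta> q (map head_symbol ts) = {}"
  shows "counts q ts T (of_bool (q = final))"
  using path_count_halt[of M "(to_nat q, ts)" T] enabled_M[of q ts] assms
  by (auto simp: counts_def M_def)

text \<open>The successors are labelled by \<open>A\<close>. Injectivity matters because paths are
  lists of rules: two choices with the same target state and the same actions would be one rule and
  count once.\<close>

lemma counts_step:
  assumes \<delta>: "\<delta> q (map head_symbol ts) = h ` A" and inj: "inj_on h A" and ne: "A \<noteq> {}"
    and step: "\<And>a. a \<in> A \<Longrightarrow> counts (fst (h a)) (map2 act (snd (h a)) ts) T (v a)"
  shows "counts q ts (Suc T) (\<Sum>a\<in>A. v a)"
  unfolding counts_def
proof
  assume good: "good q ts"
  let ?r = "\<lambda>(q', as). Rule (to_nat q) (map head_symbol ts) (to_nat q') as"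
  let ?c = "(to_nat q, ts)"
  have en: "enabled M ?c = (\<lambda>a. ?r (h a)) ` A"
    using enabled_M[OF good] by (simp add: \<delta> image_image)
  have "finite A"
    using finite_\<delta>[of q "map head_symbol ts"] inj by (simp add: \<delta> finite_image_iff)
  have "inj ?r" 
    by (auto simp: inj_def)
  with inj have injr: "inj_on (\<lambda>a. ?r (h a)) A"
    unfolding inj_on_def inj_def by blast
  have cnt: "path_count M (fire (?r (h a)) ?c) T (v a)" if "a \<in> A" for a
  proof -
    obtain q' as where ha: "h a = (q', as)" by fastforce
    then have "(q', as) \<in> \<delta> q (map head_symbol ts)"
      using that \<delta> by force
    then show ?thesis
      using step[OF that] good_step[OF good] by (simp add: ha counts_def fire_def)
  qed
  \<comment> \<open>The inverse of the injective labelling turns the sum over rules into the sum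
    over labels.\<close>
  have "path_count M ?c (Suc T) (\<Sum>\<rho>\<in>enabled M ?c. v (the_inv_into A (\<lambda>a. ?r (h a)) \<rho>))"
    by (rule path_count_step)
      (use \<open>finite A\<close> ne cnt in \<open>auto simp: en the_inv_into_f_f[OF injr]\<close>)
  also have "(\<Sum>\<rho>\<in>enabled M ?c. v (the_inv_into A (\<lambda>a. ?r (h a)) \<rho>)) = (\<Sum>a\<in>A. v a)"
    unfolding en by (subst sum.reindex[OF injr]) (auto intro!: sum.cong simp: the_inv_into_f_f[OF injr])
  finally show "path_count M ?c (Suc T) (\<Sum>a\<in>A. v a)" .
qed

text \<open>The counterpart of \<open>counts\<close> for machines that compute a function; one
  halting path is enough because \<open>prints\<close> is existential.\<close>

definition halts_with :: "'s \<Rightarrow> tape list \<Rightarrow> nat \<Rightarrow> (tape list \<Rightarrow> bool) \<Rightarrow> bool" where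
  "halts_with q ts t P \<longleftrightarrow> (good q ts \<longrightarrow>
     (\<exists>\<rho>s. halting_path M (to_nat q, ts) \<rho>s \<and> length \<rho>s \<le> t \<and> P (snd (fold fire \<rho>s (to_nat q, ts)))))"

lemma halts_with_now: "\<delta> q (map head_symbol ts) = {} \<Longrightarrow> P ts \<Longrightarrow> halts_with q ts t P"
  unfolding halts_with_def by (auto simp: halting_path_def enabled_M intro!: exI[of _ "[]"])

lemma halts_with_step:
  assumes "(q', as) \<in> \<delta> q (map head_symbol ts)" "halts_with q' (map2 act as ts) t P"
  shows "halts_with q ts (Suc t) P"
  unfolding halts_with_def
proof
  assume good: "good q ts"
  let ?\<rho> = "Rule (to_nat q) (map head_symbol ts) (to_nat q') as"
  have fire: "fire ?\<rho> (to_nat q, ts) = (to_nat q', map2 act as ts)"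
    by (simp add: fire_def)
  obtain \<rho>s where "halting_path M (to_nat q', map2 act as ts) \<rho>s" "length \<rho>s \<le> t"
    "P (snd (fold fire \<rho>s (to_nat q', map2 act as ts)))"
    using assms(2) good_step[OF good assms(1)] unfolding halts_with_def by blast
  moreover have "?\<rho> \<in> enabled M (to_nat q, ts)"
    using assms(1) unfolding enabled_M[OF good] by force
  ultimately show "\<exists>\<rho>s. halting_path M (to_nat q, ts) \<rho>s \<and> length \<rho>s \<le> Suc t \<and>
      P (snd (fold fire \<rho>s (to_nat q, ts)))"
    by (intro exI[of _ "?\<rho> # \<rho>s"]) (simp add: halting_path_def fire)
qed

lemma good_initial: "initial M x = (to_nat init, snd (initial M x))" "good init (snd (initial M x))"
  using num base init by (auto simp: initial_def M_def good_def input_tape_def blank_tape_def)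

end

section \<open>The nondeterministic simulator\<close>

datatype sim_state = Init | Pick bool | Put bool "bool list" "bool list" | Rewind | Skip | RewindU
  | Sim nat bool "bool list" | Return bool | Seek | Compare | Accept

instance sim_state :: countable
  by countable_datatype

text \<open>
  A prefix code for the coin flips of one round: \<open>None\<close> ends the experiment, \<open>Some bl\<close> appends \<open>bl\<close>
  to the program.
\<close>
fun block :: "bool list \<Rightarrow> bool list option" where
  "block (True # True # bl) = Some bl"
| "block (True # False # True # b # _) = Some [b]"
| "block (True # _) = Some []"
| "block _ = None"

lemma length_block: "block \<chi> = Some bl \<Longrightarrow> length bl \<le> length \<chi> - 2"
  by (induction \<chi> rule: block.induct) auto

definition still :: "symbol list \<Rightarrow> (symbol \<times> move) list" where
  "still = map (\<lambda>s. (s, Stay))"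

text \<open>
  A reflected Gray code counter. Every clock head sweeps between the two ends of its tape (\<open>Mark 0\<close>
  on the left, \<open>Blank\<close> on the right); the first head that is not at the end of its sweep moves, and
  all heads before it reverse. Hence every tick takes a single machine step.
\<close>
fun tick :: "bool list \<Rightarrow> symbol list \<Rightarrow> (bool list \<times> move list) option" where
  "tick (d # ds) (s # ss) =
     (if s = (if d then Blank else Mark 0)
      then map_option (\<lambda>(ds', ms). ((\<not> d) # ds', Stay # ms)) (tick ds ss)
      else Some (d # ds, (if d then MoveR else MoveL) # map (\<lambda>_. Stay) ss))"
| "tick _ _ = None"

lemma length_tick:
  "tick ds ss = Some (ds', ms) \<Longrightarrow> length ds = length ss \<Longrightarrow> length ds' = length ss \<and> length ms = length ss"
  by (induction ds ss arbitrary: ds' ms rule: tick.induct) (auto split: if_splits)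

text \<open>A halted configuration is frozen instead of ending the simulation, so that only the
  clock decides when to stop. For deterministic \<open>U\<close> the choice by \<open>SOME\<close>
  is unique.\<close>

definition next_acts :: "tm \<Rightarrow> nat \<Rightarrow> symbol list \<Rightarrow> nat \<times> (symbol \<times> move) list" where
  "next_acts U q us =
     (if \<exists>\<rho>\<in>rules U. src \<rho> = q \<and> reads \<rho> = us
      then let \<rho> = (SOME \<rho>. \<rho> \<in> rules U \<and> src \<rho> = q \<and> reads \<rho> = us) in (dst \<rho>, acts \<rho>)
      else (q, still us))"

lemma next_acts_cases:
  obtains (rule) \<rho> where "\<rho> \<in> rules U" "src \<rho> = q" "reads \<rho> = us" "next_acts U q us = (dst \<rho>, acts \<rho>)"
  | (none) "\<not> (\<exists>\<rho>\<in>rules U. src \<rho> = q \<and> reads \<rho> = us)" "next_acts U q us = (q, still us)"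
proof (cases "\<exists>\<rho>\<in>rules U. src \<rho> = q \<and> reads \<rho> = us")
  case True
  then have "\<exists>\<rho>. \<rho> \<in> rules U \<and> src \<rho> = q \<and> reads \<rho> = us" by blast
  from someI_ex[OF this] show ?thesis
    using True by (intro rule[of "SOME \<rho>. \<rho> \<in> rules U \<and> src \<rho> = q \<and> reads \<rho> = us"]) (auto simp: next_acts_def Let_def)
next
  case False
  then show ?thesis by (intro none) (auto simp: next_acts_def)
qed

definition move_last :: "move \<Rightarrow> symbol list \<Rightarrow> (symbol \<times> move) list" where
  "move_last mv us = still (butlast us) @ [(last us, mv)]"

lemma length_still [simp]: "length (still us) = length us"
  by (simp add: still_def)

lemma fst_set_still [simp]: "fst ` set (still us) = set us"
  by (force simp: still_def)

lemma length_move_last: "us \<noteq> [] \<Longrightarrow> length (move_last mv us) = length us"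
  by (simp add: move_last_def)

lemma fst_set_move_last: "us \<noteq> [] \<Longrightarrow> fst ` set (move_last mv us) = set us"
  by (induction us rule: rev_induct) (auto simp: move_last_def still_def image_image)

section \<open>The transition table of the simulator\<close>

locale simulator =
  fixes U :: tm and k j :: nat
  assumes U: "turing_machine U" and det: "deterministic U" and k: "k \<ge> 2"
begin

text \<open>Two header bits and \<open>k\<close> program bits. Shorter code words leave the
  remaining flips idle; \<open>k \<ge> 2\<close> makes room for the four flips of a round that
  appends a single bit.\<close>

definition choices :: "bool list set" where
  "choices = {\<chi>. length \<chi> = k + 2}"

text \<open>
  The tapes are the input tape, \<open>j\<close> clocks, and the tapes of \<open>U\<close>. The list \<open>\<chi>\<close> stored in a \<open>Put\<close> state
  serves only to keep the paths apart, so that every input cell contributes exactly \<open>2\<^bsup>k + 2\<^esup>\<close> choices.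
  During \<open>Sim\<close> the input head moves along with the output head of \<open>U\<close>, starting at the first cell
  of \<open>w\<close>; the flag \<open>side\<close> remembers on which side of the input it is when it reads a blank, so
  that both heads can be brought back together afterwards.
\<close>
fun trans :: "sim_state \<Rightarrow> symbol \<Rightarrow> symbol list \<Rightarrow> symbol list \<Rightarrow>
    (sim_state \<times> (symbol \<times> move) \<times> (symbol \<times> move) list \<times> (symbol \<times> move) list) set" where
  "trans Init s cs us = {(Pick False, (s, Stay), map (\<lambda>_. (Mark 0, MoveR)) cs, still us)}"
| "trans (Pick fin) s cs us =
     (if s = Blank
      then (if fin then {(Rewind, (s, MoveL), still cs, (hd us, MoveL) # still (tl us))} else {})
      else (\<lambda>\<chi>. (case (if fin then None else block \<chi>) of
                    None \<Rightarrow> Put True \<chi> [] | Some bl \<Rightarrow> Put False \<chi> bl,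
                  (s, Stay), still cs, still us)) ` choices)"
| "trans (Put fin \<chi> (b # bl)) s cs us =
     {(Put fin \<chi> bl, (s, Stay), still cs, (Bit b, MoveR) # still (tl us))}"
| "trans (Put fin \<chi> []) s cs us =
     {(Pick fin, (s, MoveR), (if fin then still cs else map (\<lambda>_. (Mark 1, MoveR)) cs), still us)}"
| "trans Rewind s cs us =
     (if s = Blank then {(Skip, (s, MoveR), still cs, still us)}
      else {(Rewind, (s, MoveL), still cs, still us)})"
| "trans Skip s cs us =
     (if s = Bit True then {(Skip, (s, MoveR), still cs, still us)}
      else if s = Bit False then {(RewindU, (Mark 0, MoveR), still cs, still us)}
      else {})"
| "trans RewindU s cs us =
     (if hd us = Blank
      then {(Sim (start U) True (replicate j False), (s, Stay), still cs, (hd us, MoveR) # still (tl us))}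
      else {(RewindU, (s, Stay), still cs, (hd us, MoveL) # still (tl us))})"
| "trans (Sim q side ds) s cs us =
     (case tick ds cs of
        None \<Rightarrow> {(Return side, (s, Stay), still cs, still us)}
      | Some (ds', ms) \<Rightarrow>
          (let (q', as) = next_acts U q us; mv = snd (last as)
           in {(Sim q' (if s = Blank then side else mv = MoveR) ds', (s, mv), zip cs ms, as)}))"
| "trans (Return side) s cs us =
     (if s = Blank
      then (let mv = (if side then MoveL else MoveR) in {(Return side, (s, mv), still cs, move_last mv us)})
      else {(Seek, (s, Stay), still cs, still us)})"
| "trans Seek s cs us =
     (if s = Blank then {(Compare, (s, MoveL), still cs, move_last MoveL us)}
      else {(Seek, (s, MoveR), still cs, move_last MoveR us)})"
| "trans Compare s cs us =
     (case s of
        Bit b \<Rightarrow> (\<lambda>a. (Compare, (Bit a, MoveL), still cs, move_last MoveL us)) `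
          (if last us = Bit b then UNIV else if last us = Bit (\<not> b) then {} else {True})
      | Mark _ \<Rightarrow> {(Accept, (s, Stay), still cs, still us)}
      | Blank \<Rightarrow> {})"
| "trans Accept s cs us = {}"

definition \<Gamma> :: "symbol set" where
  "\<Gamma> = {Blank, Bit True, Bit False, Mark 0, Mark 1} \<union> (\<Union>\<rho>\<in>rules U. fst ` set (acts \<rho>))"

definition Q :: "sim_state set" where
  "Q = {Init, Rewind, Skip, RewindU, Seek, Compare, Accept} \<union> range Pick \<union> range Return \<union>
     (\<lambda>(fin, \<chi>, bl). Put fin \<chi> bl) ` (UNIV \<times> choices \<times> {bl. length bl \<le> k}) \<union>
     (\<lambda>(q, side, ds). Sim q side ds) ` (insert (start U) (dst ` rules U) \<times> UNIV \<times> {ds. length ds = j})"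

lemma Sim_in_Q: "Sim q side ds \<in> Q \<longleftrightarrow> q \<in> insert (start U) (dst ` rules U) \<and> length ds = j"
  unfolding Q_def by (auto simp: image_iff)

lemma finite_lists_bool: "finite {bl :: bool list. length bl = n}" "finite {bl :: bool list. length bl \<le> n}"
  using finite_lists_length_eq[of "UNIV :: bool set" n] finite_lists_length_le[of "UNIV :: bool set" n]
  by simp_all

lemma finite_choices: "finite choices"
  by (simp add: choices_def finite_lists_bool)

lemma finite_Q: "finite Q"
  using U by (auto simp: Q_def finite_choices finite_lists_bool turing_machine_def)

lemma finite_\<Gamma>: "finite \<Gamma>"
  using U by (auto simp: \<Gamma>_def turing_machine_def)

lemma tapes_U: "tapes U \<ge> 1"
  using U by (simp add: turing_machine_def)

lemma next_acts_closed:
  assumes "next_acts U q us = (q', as)" "q \<in> insert (start U) (dst ` rules U)"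
    "set us \<subseteq> \<Gamma>" "length us = tapes U"
  shows "q' \<in> insert (start U) (dst ` rules U)" "length as = tapes U" "fst ` set as \<subseteq> \<Gamma>"
proof -
  consider (rule) \<rho> where "\<rho> \<in> rules U" "q' = dst \<rho>" "as = acts \<rho>" | (none) "q' = q" "as = still us"
    by (rule next_acts_cases[of U q us]) (use assms(1) in auto)
  then have "q' \<in> insert (start U) (dst ` rules U) \<and> length as = tapes U \<and> fst ` set as \<subseteq> \<Gamma>"
  proof cases
    case rule
    then show ?thesis
      using U unfolding turing_machine_def \<Gamma>_def by blast
  next
    case none
    then show ?thesis
      using assms by simp
  qed
  then show "q' \<in> insert (start U) (dst ` rules U)" "length as = tapes U" "fst ` set as \<subseteq> \<Gamma>"
    by blast+
qed

lemma marks_in_\<Gamma>: "Blank \<in> \<Gamma>" "Bit b \<in> \<Gamma>" "Mark 0 \<in> \<Gamma>" "Mark (Suc 0) \<in> \<Gamma>"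
  by (cases b) (auto simp: \<Gamma>_def)

lemma trans_closed:
  assumes "q \<in> Q" "s \<in> \<Gamma>" "set cs \<subseteq> \<Gamma>" "set us \<subseteq> \<Gamma>" "length cs = j" "length us = tapes U"
    and "(q', a, ca, ua) \<in> trans q s cs us"
  shows "q' \<in> Q \<and> fst a \<in> \<Gamma> \<and> length ca = j \<and> fst ` set ca \<subseteq> \<Gamma> \<and> length ua = tapes U \<and> fst ` set ua \<subseteq> \<Gamma>"
proof -
  have us: "us \<noteq> []" "hd us \<in> \<Gamma>" "set (tl us) \<subseteq> \<Gamma>" "Suc (tapes U - Suc 0) = tapes U"
    using assms(4,6) tapes_U by (cases us; auto)+
  note simps = Q_def choices_def marks_in_\<Gamma> image_iff length_move_last[OF us(1)] fst_set_move_last[OF us(1)]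
  show ?thesis
  proof (cases q)
    case (Pick fin)
    have "length bl \<le> k" if "block \<chi> = Some bl" "length \<chi> = k + 2" for \<chi> bl
      using length_block[OF that(1)] that(2) by simp
    then show ?thesis
      using assms us unfolding Pick by (auto simp: simps split: if_splits option.splits)
  next
    case (Put fin \<chi> bl)
    then show ?thesis
      using assms us by (cases bl) (auto simp: simps split: if_splits)
  next
    case (Sim p side ds)
    have p: "p \<in> insert (start U) (dst ` rules U)" and ds: "length ds = j"
      using assms(1) unfolding Sim Q_def by auto
    show ?thesis
    proof (cases "tick ds cs")
      case None
      then show ?thesis
        using assms us unfolding Sim by (auto simp: simps)
    next
      case (Some dm)
      obtain ds' ms p' as where dm: "dm = (ds', ms)" and p': "next_acts U p us = (p', as)"
        by fastforce
      have len: "length ds' = j" "length ms = j"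
        using length_tick[of ds cs ds' ms] Some dm ds assms(5) by auto
      have "fst ` set (zip cs ms) \<subseteq> set cs"
        by (auto dest: set_zip_leftD)
      moreover have "q' = Sim p' (if s = Blank then side else snd (last as) = MoveR) ds'"
        "a = (s, snd (last as))" "ca = zip cs ms" "ua = as"
        using assms(7) unfolding Sim trans.simps Some dm option.case prod.case Let_def p' by auto
      ultimately show ?thesis
        using next_acts_closed[OF p' p assms(4,6)] len assms(2,3,5) by (auto simp: Sim_in_Q)
    qed
  next
    case Compare
    then show ?thesis
      using assms us by (auto simp: simps split: symbol.splits if_splits)
  qed (use assms us in \<open>auto simp: simps Let_def split: if_splits\<close>)
qed

definition \<delta> :: "sim_state \<Rightarrow> symbol list \<Rightarrow> (sim_state \<times> (symbol \<times> move) list) set" where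
  "\<delta> q rs = (\<lambda>(q', a, ca, ua). (q', a # ca @ ua)) ` trans q (hd rs) (take j (tl rs)) (drop j (tl rs))"

lemma finite_trans: "finite (trans q s cs us)"
  by (induction q s cs us rule: trans.induct)
    (auto simp: finite_choices Let_def split: option.splits symbol.splits prod.splits)

sublocale finite_control "Suc (j + tapes U)" Q \<Gamma> \<delta> Init Accept
proof
  fix q rs q' as
  assume q: "q \<in> Q" and rs: "set rs \<subseteq> \<Gamma>" "length rs = Suc (j + tapes U)" and as: "(q', as) \<in> \<delta> q rs"
  obtain s rs' where s: "rs = s # rs'"
    using rs(2) by (cases rs) auto
  obtain a ca ua where 1: "(q', a, ca, ua) \<in> trans q s (take j rs') (drop j rs')" "as = a # ca @ ua"
    using as unfolding \<delta>_def s by auto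
  have "s \<in> \<Gamma>" "set (take j rs') \<subseteq> \<Gamma>" "set (drop j rs') \<subseteq> \<Gamma>"
    "length (take j rs') = j" "length (drop j rs') = tapes U"
    using rs s by (auto dest: in_set_takeD in_set_dropD)
  from trans_closed[OF q this 1(1)] 1(2)
  show "q' \<in> Q" "length as = Suc (j + tapes U) \<and> fst ` set as \<subseteq> \<Gamma>"
    by auto
qed (auto simp: finite_Q finite_\<Gamma> \<delta>_def finite_trans marks_in_\<Gamma>, auto simp: Q_def)

end

section \<open>Elementary actions on tapes, total steps of \<open>U\<close>, and the clock\<close>

lemma act_head_symbol [simp]: "act (head_symbol T, mv) T = (fst T, snd T + offset mv)"
  by (cases T) (simp add: head_symbol_def)

lemma map2_act_still [simp]: "map2 act (still (map head_symbol Ts)) Ts = Ts"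
  by (induction Ts) (simp_all add: still_def)

lemma map2_act_const [simp]: "map2 act (map (\<lambda>_. a) (map f Ts)) Ts = map (act a) Ts"
  by (induction Ts) simp_all

lemma map2_act_move_last [simp]:
  "map2 act (move_last mv (map head_symbol (Ts @ [T]))) (Ts @ [T]) = Ts @ [(fst T, snd T + offset mv)]"
  by (simp add: move_last_def)

definition ustep :: "tm \<Rightarrow> config \<Rightarrow> config" where
  "ustep U c = (let (q, as) = next_acts U (fst c) (map head_symbol (snd c)) in (q, map2 act as (snd c)))"

lemma ustep_eq:
  "next_acts U (fst c) (map head_symbol (snd c)) = (q, as) \<Longrightarrow> ustep U c = (q, map2 act as (snd c))"
  by (simp add: ustep_def)

text \<open>Twice the probability that the cell yields \<open>a\<close> when a symbol that is not a
  bit is replaced by a fair coin. The factor 2 keeps the values integral and accounts for the factor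
  \<open>2 ^ length w\<close> of the martingale.\<close>

definition agreement :: "symbol \<Rightarrow> bool \<Rightarrow> nat" where
  "agreement s a = (if s = Bit a then 2 else if s = Bit (\<not> a) then 0 else 1)"

text \<open>The cells 0 to \<open>m + 1\<close> are the \<open>m + 2\<close> values of one digit;
  each completed round adds one interior \<open>Mark 1\<close>.\<close>

definition clock_tape :: "nat \<Rightarrow> int \<Rightarrow> symbol" where
  "clock_tape m i = (if i = 0 then Mark 0 else if 1 \<le> i \<and> i \<le> int m then Mark 1 else Blank)"

definition clock_ok :: "nat \<Rightarrow> bool list \<Rightarrow> tape list \<Rightarrow> bool" where
  "clock_ok m = list_all2 (\<lambda>d C. fst C = clock_tape m \<and> 0 \<le> snd C \<and> snd C \<le> int m + 1)"

text \<open>The number shown by the Gray code, in base \<open>m + 2\<close> with the least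
  significant digit first: a digit is the distance of the head from the end towards which it
  moves.\<close>

fun ticks_left :: "nat \<Rightarrow> bool list \<Rightarrow> tape list \<Rightarrow> nat" where
  "ticks_left m (d # ds) (C # Cs) =
     nat (if d then int m + 1 - snd C else snd C) + (m + 2) * ticks_left m ds Cs"
| "ticks_left m _ _ = 0"

lemma ticks_left_start:
  "Suc (ticks_left m (replicate n False) (replicate n (clock_tape m, int m + 1))) = (m + 2) ^ n"
proof (induction n)
  case (Suc n)
  let ?t = "ticks_left m (replicate n False) (replicate n (clock_tape m, int m + 1))"
  have "Suc (ticks_left m (replicate (Suc n) False) (replicate (Suc n) (clock_tape m, int m + 1))) =
    (m + 2) * Suc ?t"
    by (simp add: nat_add_distrib)
  then show ?case
    using Suc by simp
qed simp

text \<open>A head that reverses at the end of its sweep sees its digit jump from 0 to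
  \<open>m + 1\<close>, which is a borrow from the next digit. So each tick lowers the number by
  one, and the clock stops exactly at zero.\<close>

lemma tick_correct:
  assumes "clock_ok m ds Cs"
  shows "case tick ds (map head_symbol Cs) of
      None \<Rightarrow> ticks_left m ds Cs = 0
    | Some (ds', ms) \<Rightarrow> clock_ok m ds' (map2 act (zip (map head_symbol Cs) ms) Cs) \<and>
        ticks_left m ds Cs = Suc (ticks_left m ds' (map2 act (zip (map head_symbol Cs) ms) Cs))"
  using assms unfolding clock_ok_def
proof (induction ds Cs rule: list_all2_induct)
  case (Cons d ds C Cs)
  obtain h where C: "C = (clock_tape m, h)" "0 \<le> h" "h \<le> int m + 1"
    using Cons.hyps(1) by (cases C) auto
  let ?stuck = "head_symbol C = (if d then Blank else Mark 0)"
  have head: "?stuck \<longleftrightarrow> h = (if d then int m + 1 else 0)"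
    using C by (auto simp: head_symbol_def clock_tape_def)
  show ?case
  proof (cases ?stuck)
    case True
    then show ?thesis
      using Cons.IH C head
      by (cases d; cases "tick ds (map head_symbol Cs)") (auto simp: nat_add_distrib fun_upd_idem clock_tape_def)
  next
    case False
    have still: "map2 act (zip (map head_symbol Cs) (map (\<lambda>_. Stay) (map head_symbol Cs))) Cs = Cs"
      by (induction Cs) auto
    have "(clock_tape m)(h := head_symbol (clock_tape m, h)) = clock_tape m"
      by (simp add: head_symbol_def)
    then show ?thesis
      using False Cons.hyps C head still
      by (cases d) (auto simp: o_def split: if_splits)
  qed
qed simp

section \<open>Path counts after the scan: simulation, return and comparison\<close>

context simulator
begin

lemma counts_trans:
  assumes len: "length Cs = j"
    and tr: "trans q (head_symbol T0) (map head_symbol Cs) (map head_symbol Us) = h ` A"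
    and inj: "inj_on h A" and ne: "A \<noteq> {}"
    and step: "\<And>a. a \<in> A \<Longrightarrow> \<exists>q' b ca ua. h a = (q', b, ca, ua) \<and> length ca = j \<and>
      counts q' (act b T0 # map2 act ca Cs @ map2 act ua Us) T (v a)"
  shows "counts q (T0 # Cs @ Us) (Suc T) (\<Sum>a\<in>A. v a)"
proof (rule counts_step)
  let ?g = "\<lambda>(q', b, ca, ua). (q', b # ca @ ua)"
  show "\<delta> q (map head_symbol (T0 # Cs @ Us)) = (\<lambda>a. ?g (h a)) ` A"
    using len tr by (simp add: \<delta>_def image_image)
  \<comment> \<open>The concatenation \<open>ca @ ua\<close> determines both parts because every
    \<open>ca\<close> has length \<open>j\<close>.\<close>
  show "inj_on (\<lambda>a. ?g (h a)) A"
  proof (rule inj_onI)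
    fix a a' assume a: "a \<in> A" "a' \<in> A" and eq: "?g (h a) = ?g (h a')"
    obtain q1 b1 c1 u1 q2 b2 c2 u2 where "h a = (q1, b1, c1, u1)" "length c1 = j"
      "h a' = (q2, b2, c2, u2)" "length c2 = j"
      using step a by meson
    with eq have "h a = h a'" by auto
    with inj a show "a = a'" by (auto dest: inj_onD)
  qed
  show "A \<noteq> {}" by fact
  fix a assume "a \<in> A"
  from step[OF this] obtain q' b ca ua where "h a = (q', b, ca, ua)" "length ca = j"
    "counts q' (act b T0 # map2 act ca Cs @ map2 act ua Us) T (v a)" by blast
  then show "counts (fst (?g (h a))) (map2 act (snd (?g (h a))) (T0 # Cs @ Us)) T (v a)"
    using len by simp
qed

lemma counts_det:
  assumes "length Cs = j"
    and "trans q (head_symbol T0) (map head_symbol Cs) (map head_symbol Us) = {(q', b, ca, ua)}"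
    and "length ca = j"
    and "counts q' (act b T0 # map2 act ca Cs @ map2 act ua Us) T v"
  shows "counts q (T0 # Cs @ Us) (Suc T) v"
  using counts_trans[of Cs q T0 Us "\<lambda>_. (q', b, ca, ua)" "{()}" T "\<lambda>_. v"] assms by simp

lemma counts_stuck:
  assumes "length Cs = j"
    and "trans q (head_symbol T0) (map head_symbol Cs) (map head_symbol Us) = {}"
  shows "counts q (T0 # Cs @ Us) T (of_bool (q = Accept))"
  by (rule counts_halt) (use assms in \<open>simp add: \<delta>_def\<close>)

lemma counts_move:
  assumes "length Cs = j"
    and "trans q (head_symbol T0) (map head_symbol Cs) (map head_symbol Us) =
      {(q', (head_symbol T0, mv), still (map head_symbol Cs), still (map head_symbol Us))}"
    and "counts q' ((fst T0, snd T0 + offset mv) # Cs @ Us) T v"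
  shows "counts q (T0 # Cs @ Us) (Suc T) v"
  by (rule counts_det[OF assms(1,2)]) (use assms in auto)

lemma counts_move_first:
  assumes "length Cs = j"
    and "trans q (head_symbol T0) (map head_symbol Cs) (map head_symbol (TU # Us)) =
      {(q', (head_symbol T0, mv), still (map head_symbol Cs), (head_symbol TU, mv') # still (map head_symbol Us))}"
    and "counts q' ((fst T0, snd T0 + offset mv) # Cs @ (fst TU, snd TU + offset mv') # Us) T v"
  shows "counts q (T0 # Cs @ TU # Us) (Suc T) v"
  by (rule counts_det[OF assms(1,2)]) (use assms in auto)

lemma counts_move_last:
  assumes "length Cs = j"
    and "trans q (head_symbol T0) (map head_symbol Cs) (map head_symbol (Us @ [TU])) =
      {(q', (head_symbol T0, mv), still (map head_symbol Cs), move_last mv (map head_symbol (Us @ [TU])))}"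
    and "counts q' ((fst T0, snd T0 + offset mv) # Cs @ Us @ [(fst TU, snd TU + offset mv)]) T v"
  shows "counts q (T0 # Cs @ Us @ [TU]) (Suc T) v"
  by (rule counts_det[OF assms(1,2)]) (use assms(1,3) in \<open>simp_all only: length_still length_map map2_act_still map2_act_move_last act_head_symbol\<close>)

text \<open>Both heads walk left to the \<open>Mark 0\<close> in front of \<open>w\<close>. A
  matching bit branches into two paths, a wrong bit has no successor, and any other symbol gives
  one, so the path count is a product. The two branches are told apart by the bit they write on the
  input tape, in a cell that is not visited again; hence the induction generalizes
  \<open>c\<close>.\<close>

lemma counts_compare:
  assumes "length Cs = j" "\<And>i. i < l \<Longrightarrow> c (b + int i) = Bit (w i)" "c (b - 1) = Mark 0"
  shows "counts Compare ((c, b + int l - 1) # Cs @ Us @ [(out, int l - 1)]) (Suc l)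
    (\<Prod>i<l. agreement (out (int i)) (w i))"
  using assms
proof (induction l arbitrary: c)
  case 0
  have "counts Accept ((c, b - 1) # Cs @ Us @ [(out, - 1)]) 0 (of_bool (Accept = Accept))"
    by (rule counts_stuck) (use 0 in auto)
  then show ?case
    by (intro counts_move[where q' = Accept and mv = Stay]) (use 0 in \<open>auto simp: head_symbol_def\<close>)
next
  case (Suc l)
  let ?V = "\<Prod>i<l. agreement (out (int i)) (w i)"
  let ?T = "(c, b + int l)" and ?O = "(out, int l)"
  have IH: "counts Compare ((c(b + int l := a), b + int l - 1) # Cs @ Us @ [(out, int l - 1)]) (Suc l) ?V" for a
    by (rule Suc.IH) (use Suc.prems in auto)
  let ?h = "\<lambda>a. (Compare, (Bit a, MoveL), still (map head_symbol Cs), move_last MoveL (map head_symbol (Us @ [?O])))"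
  let ?A = "if out (int l) = Bit (w l) then UNIV else if out (int l) = Bit (\<not> w l) then {} else {True}"
  have tr: "trans Compare (head_symbol ?T) (map head_symbol Cs) (map head_symbol (Us @ [?O])) = ?h ` ?A"
    using Suc.prems(2)[of l] by (simp add: head_symbol_def)
  have "counts Compare (?T # Cs @ Us @ [?O]) (Suc (Suc l)) (\<Sum>a\<in>?A. ?V)"
  proof (cases "?A = {}")
    case True
    show ?thesis
      using counts_stuck[OF Suc.prems(1), of Compare ?T "Us @ [?O]"] tr True by simp
  next
    case False
    show ?thesis
    proof (rule counts_trans[OF Suc.prems(1) tr _ False])
      show "inj_on ?h ?A" by (auto simp: inj_on_def)
      fix a
      show "\<exists>q' b' ca ua. ?h a = (q', b', ca, ua) \<and> length ca = j \<and>
        counts q' (act b' ?T # map2 act ca Cs @ map2 act ua (Us @ [?O])) (Suc l) ?V"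
        using IH[of "Bit a"] Suc.prems(1) by (simp del: map_append)
    qed
  qed
  also have "(\<Sum>a\<in>?A. ?V) = (\<Prod>i<Suc l. agreement (out (int i)) (w i))"
    by (auto simp: agreement_def)
  finally show ?case
    by (simp add: algebra_simps)
qed

text \<open>The number \<open>b\<close> is the fixed distance between the input head and the output
  head, which move in parallel from the simulation on. Finding the right end of the input thus also
  finds the output cell that belongs to the last bit of \<open>w\<close>.\<close>

lemma counts_seek:
  assumes "length Cs = j" "\<And>i. 0 \<le> i \<Longrightarrow> i < L \<Longrightarrow> c i \<noteq> Blank" "c L = Blank"
    and "0 \<le> p" "p + int n = L"
    and "counts Compare ((c, L - 1) # Cs @ Us @ [(out, L - 1 - b)]) T v"
  shows "counts Seek ((c, p) # Cs @ Us @ [(out, p - b)]) (T + n + 1) v"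
  using assms(4,5)
proof (induction n arbitrary: p)
  case 0
  have "counts Seek ((c, p) # Cs @ Us @ [(out, p - b)]) (Suc T) v"
    by (rule counts_move_last[OF assms(1), where q' = Compare and mv = MoveL])
      (use 0 assms in \<open>auto simp: head_symbol_def algebra_simps\<close>)
  then show ?case by simp
next
  case (Suc n)
  have IH: "counts Seek ((c, p + 1) # Cs @ Us @ [(out, p + 1 - b)]) (T + n + 1) v"
    by (rule Suc.IH) (use Suc.prems in auto)
  have "counts Seek ((c, p) # Cs @ Us @ [(out, p - b)]) (Suc (T + n + 1)) v"
    by (rule counts_move_last[OF assms(1), where q' = Seek and mv = MoveR])
      (use Suc.prems assms IH in \<open>auto simp: head_symbol_def algebra_simps\<close>)
  then show ?case by simp
qed

text \<open>Outside the input every cell is blank, so only \<open>side\<close> tells the way back.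
  Each move outside brings the head nearer to cell 0, which lies in the input as
  \<open>1 \<le> L\<close>; this is why the induction is on a bound for
  \<open>\<bar>p\<bar>\<close>.\<close>

lemma counts_return:
  assumes "length Cs = j" "\<And>i. c i = Blank \<longleftrightarrow> \<not> (0 \<le> i \<and> i < L)" "1 \<le> L"
    and "L \<le> p \<Longrightarrow> side" "p < 0 \<Longrightarrow> \<not> side" "nat \<bar>p\<bar> \<le> n"
    and fin: "counts Compare ((c, L - 1) # Cs @ Us @ [(out, L - 1 - b)]) T v"
  shows "counts (Return side) ((c, p) # Cs @ Us @ [(out, p - b)]) (T + nat L + n + 3) v"
  using assms(4-6)
proof (induction n arbitrary: p)
  case 0
  have "counts Seek ((c, p) # Cs @ Us @ [(out, p - b)]) (T + nat L + 1) v"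
    by (rule counts_seek[OF assms(1)]) (use assms(2,3) 0 fin in auto)
  then have "counts (Return side) ((c, p) # Cs @ Us @ [(out, p - b)]) (Suc (T + nat L + 1)) v"
    by (intro counts_move[OF assms(1), where q' = Seek and mv = Stay])
      (use assms(2,3) 0 in \<open>auto simp: head_symbol_def\<close>)
  then show ?case
    by (rule counts_mono) simp
next
  case (Suc n)
  show ?case
  proof (cases "0 \<le> p \<and> p < L")
    case True
    have "counts Seek ((c, p) # Cs @ Us @ [(out, p - b)]) (T + nat (L - p) + 1) v"
      by (rule counts_seek[OF assms(1)]) (use assms(2,3) True fin in auto)
    then have "counts (Return side) ((c, p) # Cs @ Us @ [(out, p - b)]) (Suc (T + nat (L - p) + 1)) v"
      by (intro counts_move[OF assms(1), where q' = Seek and mv = Stay])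
        (use assms(2,3) True in \<open>auto simp: head_symbol_def\<close>)
    then show ?thesis
      by (rule counts_mono) (use True in auto)
  next
    case False
    define mv where "mv = (if side then MoveL else MoveR)"
    define p' where "p' = p + offset mv"
    have IH: "counts (Return side) ((c, p') # Cs @ Us @ [(out, p' - b)]) (T + nat L + n + 3) v"
      by (rule Suc.IH) (use Suc.prems False assms(3) in \<open>auto simp: p'_def mv_def split: if_splits\<close>)
    have "counts (Return side) ((c, p) # Cs @ Us @ [(out, p - b)]) (Suc (T + nat L + n + 3)) v"
      by (rule counts_move_last[OF assms(1), where q' = "Return side" and mv = mv])
        (use False IH assms(2)[of p] in \<open>auto simp: head_symbol_def p'_def mv_def algebra_simps\<close>)
    then show ?thesis by simp
  qed
qed

lemma length_next_acts:
  assumes "next_acts U q us = (q', as)" "length us = tapes U"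
  shows "length as = tapes U"
  by (rule next_acts_cases[of U q us]) (use assms U in \<open>auto simp: turing_machine_def\<close>)

lemma snd_act: "snd (act a T) = snd T + offset (snd a)"
  by (cases a; cases T) simp

lemma last_map2_act:
  assumes "length as = length Us" "Us \<noteq> []"
  shows "last (map2 act as Us) = act (last as) (last Us)"
  using assms by (induction as Us rule: list_induct2) auto

text \<open>Stated with a continuation: \<open>fin\<close> covers whatever clocks and flag remain
  when time is up. What must be known is the configuration of \<open>U\<close>, reached after
  exactly \<open>n\<close> steps, and that the flag tells on which side of the input the head
  is.\<close>

lemma counts_sim:
  assumes c: "\<And>i. c i = Blank \<longleftrightarrow> \<not> (0 \<le> i \<and> i < L)" and L: "1 \<le> L"
    and ok: "clock_ok m ds Cs" "ticks_left m ds Cs = n" "length Cs = j" "length Us = tapes U"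
    and side: "L \<le> b + snd (last Us) \<longrightarrow> side" "b + snd (last Us) < 0 \<longrightarrow> \<not> side"
    and fin: "\<And>side Cs Us. \<lbrakk>Us = snd ((ustep U ^^ n) (q, Us0)); length Cs = j; length Us = tapes U;
        L \<le> b + snd (last Us) \<longrightarrow> side; b + snd (last Us) < 0 \<longrightarrow> \<not> side\<rbrakk> \<Longrightarrow>
      counts (Return side) ((c, b + snd (last Us)) # Cs @ Us) T v"
    and Us: "Us = Us0"
  shows "counts (Sim q side ds) ((c, b + snd (last Us)) # Cs @ Us) (T + n + 1) v"
  using ok side fin unfolding Us
proof (induction n arbitrary: q side ds Cs Us0)
  case 0
  have tick: "tick ds (map head_symbol Cs) = None"
    using tick_correct[OF 0(1)] 0(2) by (auto split: option.splits)
  have "counts (Return side) ((c, b + snd (last Us0)) # Cs @ Us0) T v"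
    by (rule 0(7)) (use 0 in auto)
  then have "counts (Sim q side ds) ((c, b + snd (last Us0)) # Cs @ Us0) (Suc T) v"
    by (intro counts_move[where q' = "Return side" and mv = Stay]) (use 0 tick in auto)
  then show ?case by simp
next
  case (Suc n)
  obtain ds' ms where tick: "tick ds (map head_symbol Cs) = Some (ds', ms)"
    using tick_correct[OF Suc.prems(1)] Suc.prems(2) by (auto split: option.splits)
  define Cs' where "Cs' = map2 act (zip (map head_symbol Cs) ms) Cs"
  have Cs': "clock_ok m ds' Cs'" "ticks_left m ds' Cs' = n"
    using tick_correct[OF Suc.prems(1)] Suc.prems(2) tick by (auto simp: Cs'_def)
  have "length ds = length Cs"
    using Suc.prems(1) by (auto simp: clock_ok_def list_all2_lengthD)
  then have ms: "length ms = j"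
    using length_tick[OF tick] Suc.prems(3) by simp
  obtain q' as where as: "next_acts U q (map head_symbol Us0) = (q', as)"
    by fastforce
  have las: "length as = length Us0"
    using length_next_acts[OF as] Suc.prems(4) by simp
  have ne: "Us0 \<noteq> []"
    using Suc.prems(4) tapes_U by auto
  define Us' where "Us' = map2 act as Us0"
  define mv where "mv = snd (last as)"
  define p where "p = b + snd (last Us0)"
  have p': "b + snd (last Us') = p + offset mv"
    using last_map2_act[OF las ne] by (simp add: Us'_def p_def mv_def snd_act)
  have step: "ustep U (q, Us0) = (q', Us')"
    by (simp add: ustep_def as Us'_def)
  \<comment> \<open>From a cell of the input, the move just made decides the side on which the head
    may leave. From outside, one step cannot jump across the input because
    \<open>1 \<le> L\<close>.\<close>
  define side' where "side' = (if c p = Blank then side else mv = MoveR)"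
  have side': "L \<le> p + offset mv \<longrightarrow> side'" "p + offset mv < 0 \<longrightarrow> \<not> side'"
    using Suc.prems(5,6) c[of p] L unfolding side'_def p_def[symmetric]
    by (cases mv; auto)+
  have "counts (Sim q' side' ds') ((c, b + snd (last Us')) # Cs' @ Us') (T + n + 1) v"
  proof (rule Suc.IH)
    show "length Cs' = j" "length Us' = tapes U"
      using ms Suc.prems(3,4) las by (simp_all add: Cs'_def Us'_def)
    fix side2 and Cs2 Us2 :: "tape list"
    assume "Us2 = snd ((ustep U ^^ n) (q', Us'))" "length Cs2 = j" "length Us2 = tapes U"
      "L \<le> b + snd (last Us2) \<longrightarrow> side2" "b + snd (last Us2) < 0 \<longrightarrow> \<not> side2"
    then show "counts (Return side2) ((c, b + snd (last Us2)) # Cs2 @ Us2) T v"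
      by (intro Suc.prems(7)) (simp_all add: funpow_Suc_right step del: funpow.simps)
  qed (use Cs' side' p' in auto)
  then have "counts (Sim q side ds) ((c, p) # Cs @ Us0) (Suc (T + n + 1)) v"
    by (intro counts_det[where q' = "Sim q' side' ds'" and b = "(c p, mv)"
          and ca = "zip (map head_symbol Cs) ms" and ua = as])
      (use Suc.prems(3) tick as ms p' in \<open>auto simp: Cs'_def Us'_def side'_def mv_def[symmetric] head_symbol_def Let_def\<close>)
  then show ?case
    by (simp add: p_def)
qed

lemma counts_rewind_program:
  assumes "length Cs = j" "\<And>i. c i = Blank \<longleftrightarrow> \<not> (0 \<le> i \<and> i < int l)"
    and "counts (Sim (start U) True (replicate j False)) (T0 # Cs @ (c, 0) # Us) T v" "n \<le> l"
  shows "counts RewindU (T0 # Cs @ (c, int n - 1) # Us) (T + n + 1) v"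
  using assms(4)
proof (induction n)
  case 0
  have "counts RewindU (T0 # Cs @ (c, - 1) # Us) (Suc T) v"
    by (rule counts_move_first[OF assms(1), where q' = "Sim (start U) True (replicate j False)" and mv = Stay and mv' = MoveR])
      (use assms in \<open>auto simp: head_symbol_def\<close>)
  then show ?case by simp
next
  case (Suc n)
  have "counts RewindU (T0 # Cs @ (c, int n) # Us) (Suc (T + n + 1)) v"
    by (rule counts_move_first[OF assms(1), where q' = RewindU and mv = Stay and mv' = MoveL])
      (use assms Suc in \<open>auto simp: head_symbol_def\<close>)
  then show ?case by simp
qed

lemma input_tape_Blank: "fst (input_tape x) i = Blank \<longleftrightarrow> \<not> (0 \<le> i \<and> i < int (length x))"
  by (simp add: input_tape_def)

lemma counts_rewind:
  assumes "length Cs = j" "\<And>i. c i = Blank \<longleftrightarrow> \<not> (0 \<le> i \<and> i < int l)"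
    and "counts Skip ((c, 0) # Cs @ Us) T v" "n \<le> l"
  shows "counts Rewind ((c, int n - 1) # Cs @ Us) (T + n + 1) v"
  using assms(4)
proof (induction n)
  case 0
  have "counts Rewind ((c, - 1) # Cs @ Us) (Suc T) v"
    by (rule counts_move[OF assms(1), where q' = Skip and mv = MoveR])
      (use assms in \<open>auto simp: head_symbol_def\<close>)
  then show ?case by simp
next
  case (Suc n)
  have "counts Rewind ((c, int n) # Cs @ Us) (Suc (T + n + 1)) v"
    by (rule counts_move[OF assms(1), where q' = Rewind and mv = MoveL])
      (use assms Suc in \<open>auto simp: head_symbol_def\<close>)
  then show ?case by simp
qed

lemma counts_skip:
  assumes "length Cs = j" "\<And>i. i < r \<Longrightarrow> c (int i) = Bit True"
    and "counts Skip ((c, int r) # Cs @ Us) T v" "n \<le> r"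
  shows "counts Skip ((c, int (r - n)) # Cs @ Us) (T + n) v"
  using assms(4)
proof (induction n)
  case 0
  then show ?case using assms by simp
next
  case (Suc n)
  have "counts Skip ((c, int (r - Suc n)) # Cs @ Us) (Suc (T + n)) v"
    by (rule counts_move[OF assms(1), where q' = Skip and mv = MoveR])
      (use assms(1) assms(2)[of "r - Suc n"] Suc in \<open>auto simp: head_symbol_def of_nat_diff\<close>)
  then show ?case by simp
qed

text \<open>Whatever stands there when time is up counts, even if \<open>U\<close> has not halted,
  so that every outcome of the flips yields a sequence.\<close>

definition out_tape :: "bool list \<Rightarrow> nat \<Rightarrow> int \<Rightarrow> symbol" where
  "out_tape \<pi> m = fst (last (snd ((ustep U ^^ ((m + 2) ^ j - 1)) (initial U \<pi>))))"

text \<open>For fixed \<open>\<pi>\<close> and \<open>m\<close> this is \<open>2 ^ length w\<close>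
  times the probability that the output, completed by coins, begins with \<open>w\<close>.\<close>

definition payoff :: "bool list \<Rightarrow> nat \<Rightarrow> bool list \<Rightarrow> nat" where
  "payoff \<pi> m w = (\<Prod>i<length w. agreement (out_tape \<pi> m (int i)) (w ! i))"

text \<open>Limits how far the output head, and with it the input head, can have strayed when the
  return begins.\<close>

lemma ustep_bounds:
  "length (snd ((ustep U ^^ n) (initial U \<pi>))) = tapes U \<and> \<bar>snd (last (snd ((ustep U ^^ n) (initial U \<pi>))))\<bar> \<le> int n"
proof (induction n)
  case 0
  have "snd T = 0" if "T \<in> set (snd (initial U \<pi>))" for T
    using that by (auto simp: initial_def input_tape_def blank_tape_def)
  moreover have "length (snd (initial U \<pi>)) = tapes U"
    using tapes_U by (simp add: initial_def)
  ultimately show ?case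
    using tapes_U last_in_set[of "snd (initial U \<pi>)"] by fastforce
next
  case (Suc n)
  let ?c = "(ustep U ^^ n) (initial U \<pi>)"
  obtain q as where as: "next_acts U (fst ?c) (map head_symbol (snd ?c)) = (q, as)"
    by fastforce
  have len: "length as = length (snd ?c)"
    using length_next_acts[OF as] Suc by simp
  have ne: "snd ?c \<noteq> []"
    using Suc tapes_U by auto
  have "\<bar>offset (snd (last as))\<bar> \<le> 1"
    by (cases "snd (last as)") auto
  with Suc have "\<bar>snd (last (snd ?c)) + offset (snd (last as))\<bar> \<le> 1 + int n"
    by linarith
  then show ?case
    using Suc len last_map2_act[OF len ne] by (simp add: ustep_eq[OF as] snd_act)
qed

definition clocks :: "nat \<Rightarrow> tape list" where
  "clocks m = replicate j (clock_tape m, int m + 1)"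

lemma length_clocks [simp]: "length (clocks m) = j"
  by (simp add: clocks_def)

lemma counts_after_scan:
  fixes r :: nat and w :: "bool list"
  defines "x \<equiv> enc w r"
  assumes "m \<le> length x" "length \<pi> \<le> l"
  shows "counts Rewind ((fst (input_tape x), int (length x) - 1) # clocks m @
      (fst (input_tape \<pi>), int (length \<pi>) - 1) # replicate (tapes U - 1) blank_tape)
    (2 * (length x + 2) ^ j + 6 * length x + l + 15) (payoff \<pi> m w)"
proof -
  let ?L = "length x" and ?n = "(m + 2) ^ j - 1" and ?N = "(length x + 2) ^ j"
  \<comment> \<open>The delimiter has become \<open>Mark 0\<close>, the left stop for the
    comparison. It is not blank, so blanks still mark exactly the outside of the input.\<close>
  let ?c = "(fst (input_tape x))(int r := Mark 0)"
  have len: "?L = r + 1 + length w"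
    by (simp add: x_def enc_def)
  have n: "?n \<le> ?N"
    using assms(2) power_mono[of "m + 2" "?L + 2" j] by simp
  have blank: "?c i = Blank \<longleftrightarrow> \<not> (0 \<le> i \<and> i < int ?L)" for i
    using len input_tape_Blank[of x i] by auto
  have init: "initial U \<pi> = (start U, (fst (input_tape \<pi>), 0) # replicate (tapes U - 1) blank_tape)"
    by (simp add: initial_def input_tape_def)
  have snd_last: "snd (last (snd (initial U \<pi>))) = 0"
    using ustep_bounds[of 0 \<pi>] by simp
  have cells: "?c (int r + 1 + int i) = Bit (w ! i)" if "i < length w" for i
  proof -
    have "fst (input_tape x) (int (r + 1 + i)) = Bit (x ! (r + 1 + i))"
      using that len by (simp add: input_tape_def del: of_nat_add of_nat_Suc)
    also have "x ! (r + 1 + i) = w ! i"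
      by (simp add: x_def enc_def nth_append)
    finally show ?thesis by (simp add: algebra_simps)
  qed
  have cmp: "counts Compare ((?c, int ?L - 1) # Cs @ Us @ [(out_tape \<pi> m, int ?L - 1 - (int r + 1))]) (Suc ?L) (payoff \<pi> m w)"
    if "length Cs = j" for Cs Us
  proof -
    have "counts Compare ((?c, int r + 1 + int (length w) - 1) # Cs @ Us @ [(out_tape \<pi> m, int (length w) - 1)])
      (Suc (length w)) (payoff \<pi> m w)"
      unfolding payoff_def by (rule counts_compare[where w = "\<lambda>i. w ! i"]) (use that cells in auto)
    then show ?thesis
      by (rule counts_mono[THEN rev_iffD1]) (simp_all add: len algebra_simps)
  qed
  have sim: "counts (Sim (start U) True (replicate j False))
    ((?c, int r + 1 + snd (last (snd (initial U \<pi>)))) # clocks m @ snd (initial U \<pi>))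
    (Suc ?L + ?L + (?L + ?N) + 3 + ?n + 1) (payoff \<pi> m w)"
  proof (rule counts_sim[where Us0 = "snd (initial U \<pi>)" and m = m])
    show "clock_ok m (replicate j False) (clocks m)"
      by (simp add: clock_ok_def clocks_def list_all2_conv_all_nth)
    show "ticks_left m (replicate j False) (clocks m) = ?n"
      using ticks_left_start[of m j] by (simp add: clocks_def)
    show "length (snd (initial U \<pi>)) = tapes U"
      using ustep_bounds[of 0] by simp
    fix side and Cs Us :: "tape list"
    assume Us: "Us = snd ((ustep U ^^ ?n) (start U, snd (initial U \<pi>)))" and Cs: "length Cs = j"
      and lenU: "length Us = tapes U"
      and side: "int ?L \<le> int r + 1 + snd (last Us) \<longrightarrow> side" "int r + 1 + snd (last Us) < 0 \<longrightarrow> \<not> side"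
    have Us': "Us = snd ((ustep U ^^ ?n) (initial U \<pi>))"
      using Us by (simp add: init)
    have "Us \<noteq> []"
      using lenU tapes_U by auto
    then obtain Ub p where Ub: "Us = Ub @ [(out_tape \<pi> m, p)]"
      unfolding out_tape_def Us'[symmetric] by (cases Us rule: rev_cases) auto
    have "\<bar>p\<bar> \<le> int ?n"
      using ustep_bounds[of ?n \<pi>] unfolding Us'[symmetric] Ub by simp
    then have "nat \<bar>int r + 1 + p\<bar> \<le> ?L + ?N"
      using n len by linarith
    then have "counts (Return side) ((?c, int r + 1 + p) # Cs @ Ub @ [(out_tape \<pi> m, int r + 1 + p - (int r + 1))])
        (Suc ?L + nat (int ?L) + (?L + ?N) + 3) (payoff \<pi> m w)"
    proof (intro counts_return[OF Cs blank])
      show "counts Compare ((?c, int ?L - 1) # Cs @ Ub @ [(out_tape \<pi> m, int ?L - 1 - (int r + 1))])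
        (Suc ?L) (payoff \<pi> m w)"
        by (rule cmp[OF Cs])
    qed (use side len in \<open>auto simp: Ub\<close>)
    then show "counts (Return side) ((?c, int r + 1 + snd (last Us)) # Cs @ Us)
        (Suc ?L + ?L + (?L + ?N) + 3) (payoff \<pi> m w)"
      by (simp add: Ub)
  qed (use blank len snd_last in auto)
  let ?P = "(fst (input_tape \<pi>), int (length \<pi>) - 1)" and ?B = "replicate (tapes U - 1) blank_tape"
  have "counts RewindU ((?c, int r + 1) # clocks m @ ?P # ?B)
    (Suc ?L + ?L + (?L + ?N) + 3 + ?n + 1 + length \<pi> + 1) (payoff \<pi> m w)"
    by (rule counts_rewind_program) (use sim snd_last init input_tape_Blank in auto)
  moreover have act_delim: "act (Mark 0, MoveR) (fst (input_tape x), int r) = (?c, int r + 1)"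
    by simp
  moreover have tr: "trans Skip (head_symbol (fst (input_tape x), int r)) cs us = {(RewindU, (Mark 0, MoveR), still cs, still us)}" for cs us
    by (simp add: head_symbol_def input_tape_def x_def enc_def nth_append)
  ultimately have "counts Skip ((fst (input_tape x), int r) # clocks m @ ?P # ?B)
    (Suc (Suc ?L + ?L + (?L + ?N) + 3 + ?n + 1 + length \<pi> + 1)) (payoff \<pi> m w)"
    by (intro counts_det[where q' = RewindU and b = "(Mark 0, MoveR)"
          and ca = "still (map head_symbol (clocks m))" and ua = "still (map head_symbol (?P # ?B))"])
      (simp_all only: map2_act_still act_delim tr length_still length_map length_clocks)
  then have "counts Skip ((fst (input_tape x), int (r - r)) # clocks m @ ?P # ?B)
    (Suc (Suc ?L + ?L + (?L + ?N) + 3 + ?n + 1 + length \<pi> + 1) + r) (payoff \<pi> m w)"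
    by (intro counts_skip) (auto simp: input_tape_def x_def enc_def nth_append)
  then have "counts Rewind ((fst (input_tape x), int ?L - 1) # clocks m @ ?P # ?B)
    (Suc (Suc ?L + ?L + (?L + ?N) + 3 + ?n + 1 + length \<pi> + 1) + r + ?L + 1) (payoff \<pi> m w)"
    by (intro counts_rewind) (auto simp: input_tape_Blank)
  then show ?thesis
    by (rule counts_mono) (use n len assms(3) in linarith)
qed

end

section \<open>Path counts of the scan, and the #P function\<close>

abbreviation program_tape :: "bool list \<Rightarrow> tape" where
  "program_tape \<pi> \<equiv> (fst (input_tape \<pi>), int (length \<pi>))"

lemma act_program_tape: "act (Bit b, MoveR) (program_tape \<pi>) = program_tape (\<pi> @ [b])"
  by (auto simp: input_tape_def nth_append fun_eq_iff)

context simulator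
begin

lemma counts_put:
  assumes "length Cs = j" "counts (Put fin \<chi> []) (T0 # Cs @ program_tape (\<pi> @ bl) # Us) T v"
  shows "counts (Put fin \<chi> bl) (T0 # Cs @ program_tape \<pi> # Us) (T + length bl) v"
  using assms(2)
proof (induction bl arbitrary: \<pi>)
  case (Cons b bl)
  have IH: "counts (Put fin \<chi> bl) (T0 # Cs @ act (Bit b, MoveR) (program_tape \<pi>) # Us) (T + length bl) v"
    unfolding act_program_tape by (rule Cons.IH) (use Cons.prems in simp)
  have "counts (Put fin \<chi> (b # bl)) (T0 # Cs @ program_tape \<pi> # Us) (Suc (T + length bl)) v"
  proof (rule counts_det[OF assms(1)])
    show "trans (Put fin \<chi> (b # bl)) (head_symbol T0) (map head_symbol Cs) (map head_symbol (program_tape \<pi> # Us)) =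
      {(Put fin \<chi> bl, (head_symbol T0, Stay), still (map head_symbol Cs), (Bit b, MoveR) # still (map head_symbol Us))}"
      by simp
    show "length (still (map head_symbol Cs)) = j"
      using assms(1) by simp
    show "counts (Put fin \<chi> bl) (act (head_symbol T0, Stay) T0 # map2 act (still (map head_symbol Cs)) Cs @
      map2 act ((Bit b, MoveR) # still (map head_symbol Us)) (program_tape \<pi> # Us)) (T + length bl) v"
      using IH by (simp del: act.simps)
  qed
  then show ?case by simp
qed simp

text \<open>Here \<open>l\<close> input cells remain and \<open>m\<close> rounds have been
  completed. Cells after the stop still contribute all choices, so that all outcomes have the same
  denominator; an experiment that has not stopped by the end of the input counts nothing.\<close>

fun scan_value :: "(bool list \<Rightarrow> nat \<Rightarrow> nat) \<Rightarrow> bool \<Rightarrow> bool list \<Rightarrow> nat \<Rightarrow> nat \<Rightarrow> nat" where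
  "scan_value V fin \<pi> m 0 = (if fin then V \<pi> m else 0)"
| "scan_value V fin \<pi> m (Suc l) =
     (\<Sum>\<chi>\<in>choices. case (if fin then None else block \<chi>) of
        None \<Rightarrow> scan_value V True \<pi> m l | Some bl \<Rightarrow> scan_value V False (\<pi> @ bl) (Suc m) l)"

lemma clocks_Suc: "map (act (Mark 1, MoveR)) (clocks m) = clocks (Suc m)"
  by (auto simp: clocks_def clock_tape_def fun_eq_iff)

lemma choices_nonempty: "choices \<noteq> {}"
  using length_replicate[of "k + 2" True] unfolding choices_def by blast

text \<open>A cell costs at most \<open>k + 2\<close> steps: one for the choice, up to
  \<open>k\<close> for the block, one to move on. \<open>V\<close> is arbitrary so that inputs
  without a delimiter are covered as well.\<close>

lemma counts_scan:
  assumes rew: "\<And>\<pi> m. m \<le> length x \<Longrightarrow> length \<pi> \<le> k * m \<Longrightarrow>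
      counts Rewind ((fst (input_tape x), int (length x) - 1) # clocks m @
        (fst (input_tape \<pi>), int (length \<pi>) - 1) # Us) T (V \<pi> m)"
    and "m + l \<le> length x" "length \<pi> \<le> k * m"
  shows "counts (Pick fin) ((fst (input_tape x), int (length x - l)) # clocks m @ program_tape \<pi> # Us)
    (Suc T + l * (k + 2)) (scan_value V fin \<pi> m l)"
  using assms(2,3)
proof (induction l arbitrary: fin m \<pi>)
  case 0
  have blank: "head_symbol (fst (input_tape x), int (length x)) = Blank"
    by (simp add: head_symbol_def input_tape_def)
  show ?case
  proof (cases fin)
    case True
    have "counts (Pick fin) ((fst (input_tape x), int (length x)) # clocks m @ program_tape \<pi> # Us) (Suc T) (V \<pi> m)"
      by (rule counts_move_first[where q' = Rewind and mv = MoveL and mv' = MoveL])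
        (use True blank rew[of m \<pi>] 0 in auto)
    then show ?thesis
      using True by simp
  next
    case False
    have "counts (Pick fin) ((fst (input_tape x), int (length x)) # clocks m @ program_tape \<pi> # Us) (Suc T)
      (of_bool (Pick fin = Accept))"
      by (rule counts_stuck) (use False blank in auto)
    then show ?thesis
      using False by simp
  qed
next
  case (Suc l)
  let ?i = "int (length x - Suc l)"
  let ?T0 = "(fst (input_tape x), ?i)"
  have i: "?i + 1 = int (length x - l)"
    using Suc.prems by auto
  have nonblank: "head_symbol ?T0 \<noteq> Blank"
    using Suc.prems by (auto simp: head_symbol_def input_tape_def)
  let ?q = "\<lambda>\<chi>. case (if fin then None else block \<chi>) of None \<Rightarrow> Put True \<chi> [] | Some bl \<Rightarrow> Put False \<chi> bl"
  let ?v = "\<lambda>\<chi>. case (if fin then None else block \<chi>) of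
        None \<Rightarrow> scan_value V True \<pi> m l | Some bl \<Rightarrow> scan_value V False (\<pi> @ bl) (Suc m) l"
  let ?h = "\<lambda>\<chi>. (?q \<chi>, (head_symbol ?T0, Stay), still (map head_symbol (clocks m)),
    still (map head_symbol (program_tape \<pi> # Us)))"
  have "counts (Pick fin) (?T0 # clocks m @ program_tape \<pi> # Us) (Suc (Suc (Suc T + l * (k + 2)) + k))
    (\<Sum>\<chi>\<in>choices. ?v \<chi>)"
  proof (rule counts_trans)
    show "trans (Pick fin) (head_symbol ?T0) (map head_symbol (clocks m)) (map head_symbol (program_tape \<pi> # Us)) = ?h ` choices"
      using nonblank by simp
    show "inj_on ?h choices"
      by (auto simp: inj_on_def split: option.splits if_splits)
    fix \<chi> assume \<chi>: "\<chi> \<in> choices"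
    have "counts (?q \<chi>) (?T0 # clocks m @ program_tape \<pi> # Us) (Suc (Suc T + l * (k + 2)) + k) (?v \<chi>)"
    proof (cases "if fin then None else block \<chi>")
      case None
      have "counts (Pick True) ((fst (input_tape x), int (length x - l)) # clocks m @ program_tape \<pi> # Us)
        (Suc T + l * (k + 2)) (?v \<chi>)"
        using Suc.IH[of m \<pi> True] Suc.prems by (simp add: None)
      then have "counts (Put True \<chi> []) (?T0 # clocks m @ program_tape \<pi> # Us) (Suc (Suc T + l * (k + 2))) (?v \<chi>)"
        by (intro counts_move[where q' = "Pick True" and mv = MoveR]) (simp_all add: i)
      then show ?thesis
        using None by (auto intro: counts_mono)
    next
      case (Some bl)
      then have "block \<chi> = Some bl"
        by (auto split: if_splits)
      then have bl: "length bl \<le> k"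
        using length_block[of \<chi> bl] \<chi> by (simp add: choices_def)
      have "counts (Pick False) ((fst (input_tape x), int (length x - l)) # clocks (Suc m) @ program_tape (\<pi> @ bl) # Us)
        (Suc T + l * (k + 2)) (?v \<chi>)"
        using Suc.IH[of "Suc m" "\<pi> @ bl" False] Suc.prems bl by (simp add: Some)
      then have "counts (Put False \<chi> []) (?T0 # clocks m @ program_tape (\<pi> @ bl) # Us) (Suc (Suc T + l * (k + 2))) (?v \<chi>)"
        by (intro counts_det[where q' = "Pick False" and b = "(head_symbol ?T0, MoveR)"
              and ca = "map (\<lambda>_. (Mark 1, MoveR)) (map head_symbol (clocks m))"
              and ua = "still (map head_symbol (program_tape (\<pi> @ bl) # Us))"])
          (simp_all only: map2_act_const clocks_Suc map2_act_still act_head_symbol i trans.simps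
            offset.simps fst_conv snd_conv if_False length_map length_clocks)
      then have "counts (Put False \<chi> bl) (?T0 # clocks m @ program_tape \<pi> # Us)
          (Suc (Suc T + l * (k + 2)) + length bl) (?v \<chi>)"
        by (intro counts_put) auto
      then show ?thesis
        unfolding Some option.case by (rule counts_mono) (use bl in simp)
    qed
    then show "\<exists>q' b ca ua. ?h \<chi> = (q', b, ca, ua) \<and> length ca = j \<and>
       counts q' (act b ?T0 # map2 act ca (clocks m) @ map2 act ua (program_tape \<pi> # Us))
         (Suc (Suc T + l * (k + 2)) + k) (?v \<chi>)"
      by (intro exI[of _ "?q \<chi>"] exI[of _ "(head_symbol ?T0, Stay)"]
            exI[of _ "still (map head_symbol (clocks m))"] exI[of _ "still (map head_symbol (program_tape \<pi> # Us))"])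
        (simp only: map2_act_still act_head_symbol offset.simps fst_conv snd_conv add_0_right
          length_still length_map length_clocks simp_thms)
  qed (simp_all add: choices_nonempty)
  also have "Suc (Suc (Suc T + l * (k + 2)) + k) = Suc T + Suc l * (k + 2)"
    by simp
  finally show ?case
    unfolding scan_value.simps .
qed

definition path_total :: "bool list \<Rightarrow> nat" where
  "path_total x = card {\<rho>s. accepting_path M (initial M x) \<rho>s}"

definition run_time :: "nat \<Rightarrow> nat" where
  "run_time L = 2 * (L + 2) ^ j + 6 * L + k * L + 15 + L * (k + 2) + 2"

lemma path_count_initial:
  assumes rew: "\<And>\<pi> m. m \<le> length x \<Longrightarrow> length \<pi> \<le> k * m \<Longrightarrow>
      counts Rewind ((fst (input_tape x), int (length x) - 1) # clocks m @
        (fst (input_tape \<pi>), int (length \<pi>) - 1) # replicate (tapes U - 1) blank_tape)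
        (2 * (length x + 2) ^ j + 6 * length x + k * length x + 15) (V \<pi> m)"
  shows "path_count M (initial M x) (run_time (length x)) (scan_value V False [] 0 (length x))"
proof -
  let ?T = "2 * (length x + 2) ^ j + 6 * length x + k * length x + 15"
  let ?B = "replicate (tapes U - 1) blank_tape"
  have ini: "snd (initial M x) = (fst (input_tape x), 0) # replicate j blank_tape @ program_tape [] # ?B"
  proof -
    have "replicate (j + tapes U) blank_tape = replicate j blank_tape @ blank_tape # ?B"
      using tapes_U by (simp add: replicate_add flip: replicate_Suc)
    moreover have "program_tape [] = blank_tape"
      by (auto simp: input_tape_def blank_tape_def)
    moreover have "input_tape x = (fst (input_tape x), 0)"
      by (simp add: input_tape_def)
    ultimately show ?thesis
      by (simp add: initial_def M_def)
  qed
  have c0: "map (act (Mark 0, MoveR)) (replicate j blank_tape) = clocks 0"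
    by (auto simp: clocks_def clock_tape_def blank_tape_def fun_eq_iff)
  have "counts (Pick False) ((fst (input_tape x), int (length x - length x)) # clocks 0 @ program_tape [] # ?B)
    (Suc ?T + length x * (k + 2)) (scan_value V False [] 0 (length x))"
    by (rule counts_scan) (use rew in auto)
  then have "counts Init ((fst (input_tape x), 0) # replicate j blank_tape @ program_tape [] # ?B)
    (Suc (Suc ?T + length x * (k + 2))) (scan_value V False [] 0 (length x))"
    by (intro counts_det[where q' = "Pick False" and b = "(head_symbol (fst (input_tape x), 0), Stay)"
              and ca = "map (\<lambda>_. (Mark 0, MoveR)) (map head_symbol (replicate j blank_tape))"
              and ua = "still (map head_symbol (program_tape [] # ?B))"])
          (simp_all only: map2_act_const c0 map2_act_still act_head_symbol trans.simps
            offset.simps fst_conv snd_conv length_map length_replicate diff_self_eq_0 of_nat_0 add_0_right)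
  then have "path_count M (to_nat Init, snd (initial M x)) (Suc (Suc ?T + length x * (k + 2))) (scan_value V False [] 0 (length x))"
    using good_initial(2)[of x] unfolding counts_def ini by blast
  then show ?thesis
    using good_initial(1)[of x] unfolding run_time_def by (simp add: add_ac)
qed

text \<open>The time bound in \<open>sharpP\<close> concerns all inputs, and the only strings that
  encode no pair consist of ones.\<close>

lemma enc_or_ones: "(\<exists>w r. x = enc w r) \<or> x = replicate (length x) True"
proof (cases "False \<in> set x")
  case True
  then obtain ys zs where "x = ys @ False # zs" "False \<notin> set ys"
    using split_list_first by metis
  then have "x = enc zs (length ys)"
    by (simp add: enc_def) (metis (full_types) replicate_eqI)
  then show ?thesis by blast
next
  case False
  then show ?thesis
    by (metis (full_types) replicate_eqI)
qed

lemma path_count_enc: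
  "path_count M (initial M (enc w r)) (run_time (length (enc w r)))
    (scan_value (\<lambda>\<pi> m. payoff \<pi> m w) False [] 0 (length (enc w r)))"
proof (rule path_count_initial)
  fix \<pi> :: "bool list" and m
  assume "m \<le> length (enc w r)" "length \<pi> \<le> k * m"
  moreover from this have "length \<pi> \<le> k * length (enc w r)"
    by (meson le_trans mult_le_mono2)
  ultimately show "counts Rewind
     ((fst (input_tape (enc w r)), int (length (enc w r)) - 1) # clocks m @
      (fst (input_tape \<pi>), int (length \<pi>) - 1) # replicate (tapes U - 1) blank_tape)
     (2 * (length (enc w r) + 2) ^ j + 6 * length (enc w r) + k * length (enc w r) + 15) (payoff \<pi> m w)"
    by (intro counts_after_scan)
qed

text \<open>Without a delimiter \<open>Skip\<close> runs into the blank after the input and gets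
  stuck in a rejecting state.\<close>

lemma path_count_ones:
  "path_count M (initial M (replicate n True)) (run_time n) (scan_value (\<lambda>\<pi> m. 0) False [] 0 n)"
proof -
  let ?x = "replicate n True"
  have "counts Rewind ((fst (input_tape ?x), int n - 1) # clocks m @ Us)
     (2 * (n + 2) ^ j + 6 * n + k * n + 15) 0" for m Us
  proof -
    have "counts Skip ((fst (input_tape ?x), int n) # clocks m @ Us) 0 (of_bool (Skip = Accept))"
      by (rule counts_stuck) (auto simp: head_symbol_def input_tape_def)
    then have "counts Skip ((fst (input_tape ?x), int (n - n)) # clocks m @ Us) (0 + n) 0"
      by (intro counts_skip) (auto simp: input_tape_def)
    then have "counts Rewind ((fst (input_tape ?x), int n - 1) # clocks m @ Us) (0 + n + n + 1) 0"
      by (intro counts_rewind[where l = n]) (auto simp: input_tape_def)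
    then show ?thesis
      by (rule counts_mono) simp
  qed
  then show ?thesis
    using path_count_initial[of ?x "\<lambda>_ _. 0"] by simp
qed

lemma sharpP_path_total: "sharpP path_total"
  unfolding sharpP_def
proof (intro exI conjI allI impI)
  let ?p = "smult 2 ([:2, 1:] ^ j) + [:17, 2 * k + 8:] :: nat poly"
  have p: "poly ?p L = run_time L" for L
    by (simp add: run_time_def poly_power algebra_simps)
  show "turing_machine M"
    by (rule turing_machine_M)
  fix x \<rho>s
  assume "path M (initial M x) \<rho>s"
  moreover have "\<exists>v. path_count M (initial M x) (run_time (length x)) v"
    using enc_or_ones[of x] path_count_enc path_count_ones by metis
  ultimately show "length \<rho>s \<le> poly ?p (length x)"
    unfolding p path_count_def by blast
qed (simp add: path_total_def)

lemma path_total_enc: "path_total (enc w r) = scan_value (\<lambda>\<pi> m. payoff \<pi> m w) False [] 0 (length (enc w r))"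
  using path_count_enc[of w r] by (simp add: path_total_def path_count_def)

end

section \<open>Printing powers of two\<close>

text \<open>Prints the denominators in binary, as a one followed by \<open>N\<close> zeros for each
  input cell. In a state \<open>i \<ge> 1\<close>, \<open>i - 1\<close> zeros have been written for
  the current cell.\<close>

locale power_printer =
  fixes N :: nat
  assumes N: "N \<ge> 1"
begin

fun step :: "nat \<Rightarrow> symbol list \<Rightarrow> (nat \<times> (symbol \<times> move) list) set" where
  "step 0 rs = {(1, [(hd rs, Stay), (Bit True, MoveR)])}"
| "step (Suc i) rs =
     (if hd rs = Blank then {}
      else if Suc i < N then {(Suc (Suc i), [(hd rs, Stay), (Bit False, MoveR)])}
      else {(1, [(hd rs, MoveR), (Bit False, MoveR)])})"

sublocale finite_control 2 "{0..N}" "{Blank, Bit True, Bit False}" step 0 0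
proof
  fix q rs q' as
  assume "q \<in> {0..N}" "set rs \<subseteq> {Blank, Bit True, Bit False}" "length rs = 2" "(q', as) \<in> step q rs"
  then show "q' \<in> {0..N}" "length as = 2 \<and> fst ` set as \<subseteq> {Blank, Bit True, Bit False}"
    using N by (cases rs; cases q; auto split: if_splits)+
next
  fix q rs
  show "finite (step q rs)"
    by (cases q) auto
next
  show "Bit b \<in> {Blank, Bit True, Bit False}" for b
    by (cases b) auto
qed auto

lemma halts_zeros:
  assumes "1 \<le> i" "i \<le> N" "p \<le> length x" "N * p + (i - 1) + n = N * length x"
  shows "halts_with i [(fst (input_tape x), int p), program_tape (True # replicate (N * p + (i - 1)) False)] n
    (\<lambda>ts. last ts = program_tape (True # replicate (N * length x) False))"
  using assms
proof (induction n arbitrary: i p)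
  case 0
  have p: "p = length x"
  proof (rule ccontr)
    assume "p \<noteq> length x"
    then have "N * Suc p \<le> N * length x"
      using 0 by (intro mult_le_mono2) simp
    then show False
      using 0 by simp
  qed
  moreover from this 0 have "i = 1"
    by simp
  ultimately show ?case
    by (intro halts_with_now) (auto simp: head_symbol_def input_tape_def)
next
  case (Suc n)
  have "p < length x"
    using Suc.prems by (cases "p = length x") auto
  then have nb: "head_symbol (fst (input_tape x), int p) \<noteq> Blank"
    by (simp add: head_symbol_def input_tape_def)
  obtain i' where i': "i = Suc i'"
    using Suc.prems by (cases i) auto
  let ?T = "(fst (input_tape x), int p)" and ?O = "program_tape (True # replicate (N * p + i') False)"
  have O: "act (Bit False, MoveR) ?O = program_tape (True # replicate (Suc (N * p + i')) False)"
    unfolding act_program_tape by (simp add: replicate_append_same)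
  show ?case
  proof (cases "i < N")
    case True
    have "halts_with (Suc i) [?T, program_tape (True # replicate (N * p + (Suc i - 1)) False)] n
      (\<lambda>ts. last ts = program_tape (True # replicate (N * length x) False))"
      by (rule Suc.IH) (use Suc.prems True in auto)
    then have "halts_with (Suc i) (map2 act [(head_symbol ?T, Stay), (Bit False, MoveR)] [?T, ?O]) n
      (\<lambda>ts. last ts = program_tape (True # replicate (N * length x) False))"
      using O i' by (simp del: act.simps)
    then have "halts_with i [?T, ?O] (Suc n) (\<lambda>ts. last ts = program_tape (True # replicate (N * length x) False))"
      by (rule halts_with_step[rotated]) (use nb True i' in auto)
    then show ?thesis
      using i' by simp
  next
    case False
    have IH: "halts_with 1 [(fst (input_tape x), int (Suc p)), program_tape (True # replicate (N * Suc p + (1 - 1)) False)] n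
      (\<lambda>ts. last ts = program_tape (True # replicate (N * length x) False))"
      by (rule Suc.IH) (use Suc.prems N \<open>p < length x\<close> False in auto)
    have eq: "Suc (N * p + i') = N * Suc p + (1 - 1)"
      using False Suc.prems i' by simp
    have "halts_with 1 (map2 act [(head_symbol ?T, MoveR), (Bit False, MoveR)] [?T, ?O]) n
      (\<lambda>ts. last ts = program_tape (True # replicate (N * length x) False))"
    proof -
      have "map2 act [(head_symbol ?T, MoveR), (Bit False, MoveR)] [?T, ?O] =
        [(fst (input_tape x), int (Suc p)), act (Bit False, MoveR) ?O]"
        by (simp del: act.simps)
      then show ?thesis
        using IH eq unfolding O by metis
    qed
    then have "halts_with i [?T, ?O] (Suc n) (\<lambda>ts. last ts = program_tape (True # replicate (N * length x) False))"
      by (rule halts_with_step[rotated]) (use nb False i' in auto)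
    then show ?thesis
      using i' by simp
  qed
qed

lemma halts_start:
  "halts_with 0 [(fst (input_tape x), 0), blank_tape] (Suc (N * length x))
    (\<lambda>ts. last ts = program_tape (True # replicate (N * length x) False))"
proof -
  have b: "act (Bit True, MoveR) blank_tape = program_tape [True]"
    by (auto simp: blank_tape_def input_tape_def fun_eq_iff)
  have "halts_with 1 [(fst (input_tape x), int 0), program_tape (True # replicate (N * 0 + (1 - 1)) False)] (N * length x)
    (\<lambda>ts. last ts = program_tape (True # replicate (N * length x) False))"
    by (rule halts_zeros) (use N in auto)
  then have "halts_with 1 (map2 act [(head_symbol (fst (input_tape x), 0), Stay), (Bit True, MoveR)]
      [(fst (input_tape x), 0), blank_tape]) (N * length x)
    (\<lambda>ts. last ts = program_tape (True # replicate (N * length x) False))"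
    using b by (simp del: act.simps)
  then show ?thesis
    by (rule halts_with_step[rotated]) simp
qed

lemma polytime_power: "polytime_computable (\<lambda>x. 2 ^ (N * length x))"
  unfolding polytime_computable_def
proof (intro exI[of _ M] exI[of _ "[:1, N:] :: nat poly"] conjI allI)
  show "turing_machine M"
    by (rule turing_machine_M)
  show "deterministic M"
  proof (rule deterministic_M)
    fix q rs x y
    assume "x \<in> step q rs" "y \<in> step q rs"
    then show "x = y"
      by (cases q) (auto split: if_splits)
  qed
  fix x :: "bool list"
  let ?y = "True # replicate (N * length x) False"
  have ts: "snd (initial M x) = [(fst (input_tape x), 0), blank_tape]"
    by (simp add: initial_def M_def input_tape_def)
  have show_y: "tape_shows (program_tape y) y" for y
    by (simp add: tape_shows_def input_tape_def)
  have "prints M x ?y (poly [:1, N:] (length x))"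
  proof -
    obtain \<rho>s where \<rho>s: "halting_path M (initial M x) \<rho>s" "length \<rho>s \<le> Suc (N * length x)"
      "last (snd (fold fire \<rho>s (initial M x))) = program_tape ?y"
      using halts_start[of x] good_initial[of x] unfolding halts_with_def ts by auto
    have "Suc (N * length x) = poly [:1, N:] (length x)"
      by simp
    with \<rho>s show_y show ?thesis
      unfolding prints_def by metis
  qed
  moreover have "horner_sum of_bool (2::nat) (replicate n False @ [True]) = 2 ^ n" for n
    by (induction n) auto
  then have "(2::nat) ^ (N * length x) = horner_sum of_bool 2 (rev ?y)"
    by simp
  ultimately show "\<exists>y. prints M x y (poly [:1, N:] (length x)) \<and> 2 ^ (N * length x) = horner_sum of_bool (2::nat) (rev y)"
    by blast
qed

end

section \<open>The martingale\<close>

text \<open>The base is at least 2, so \<open>k\<close> and the coefficients can be absorbed into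
  the exponent. Hence a clock that knows only the number of rounds outlasts \<open>p\<close> at all
  lengths up to \<open>k * m\<close>.\<close>

lemma poly_le_power:
  fixes p :: "nat poly"
  shows "\<exists>j. \<forall>m n. n \<le> k * m \<longrightarrow> poly p n < (m + 2) ^ j"
proof (induction p)
  case 0
  then show ?case by (intro exI[of _ 0]) simp
next
  case (pCons a p)
  then obtain j where j: "\<And>m n. n \<le> k * m \<Longrightarrow> poly p n < (m + 2) ^ j" by blast
  show ?case
  proof (intro exI[of _ "Suc (a + (k + 1 + j))"] allI impI)
    fix m n assume n: "n \<le> k * m"
    let ?x = "m + 2"
    have small: "i < ?x ^ i" for i
      using less_exp[of i] power_mono[of 2 ?x i] by linarith
    have "n * poly p n \<le> (k * m) * ?x ^ j"
      using n j[OF n] by (intro mult_mono) auto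
    also have "\<dots> \<le> (?x ^ k * ?x) * ?x ^ j"
      using small[of k] by (intro mult_mono) auto
    finally have le: "n * poly p n \<le> ?x ^ (k + 1 + j)"
      by (simp add: power_add algebra_simps)
    have "?x ^ a \<le> ?x ^ (a + (k + 1 + j))" "?x ^ (k + 1 + j) \<le> ?x ^ (a + (k + 1 + j))"
      by (intro power_increasing; simp)+
    moreover have "2 * ?x ^ (a + (k + 1 + j)) \<le> ?x ^ Suc (a + (k + 1 + j))"
      by simp
    ultimately show "poly (pCons a p) n < ?x ^ Suc (a + (k + 1 + j))"
      using small[of a] le unfolding poly_pCons by linarith
  qed
qed

lemma ustep_halted: "enabled U c = {} \<Longrightarrow> ustep U c = c"
proof -
  assume *: "enabled U c = {}"
  have "next_acts U (fst c) (map head_symbol (snd c)) = (fst c, still (map head_symbol (snd c)))"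
    by (rule next_acts_cases[of U "fst c" "map head_symbol (snd c)"]) (use * in \<open>auto simp: enabled_def\<close>)
  from ustep_eq[OF this] show ?thesis
    by simp
qed

lemma ustep_enabled:
  assumes "deterministic U" "\<rho> \<in> enabled U c"
  shows "ustep U c = fire \<rho> c"
proof (rule next_acts_cases[of U "fst c" "map head_symbol (snd c)"])
  fix \<rho>'
  assume \<rho>': "\<rho>' \<in> rules U" "src \<rho>' = fst c" "reads \<rho>' = map head_symbol (snd c)"
    and acts: "next_acts U (fst c) (map head_symbol (snd c)) = (dst \<rho>', acts \<rho>')"
  then have "\<rho>' = \<rho>"
    using assms unfolding deterministic_def enabled_def by auto
  then show ?thesis
    using ustep_eq[OF acts] by (simp add: fire_def)
qed (use assms(2) in \<open>auto simp: enabled_def\<close>)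

text \<open>Halted configurations are fixed points of \<open>ustep\<close>, so the clock only has to
  be long enough, not exact.\<close>

lemma ustep_halting_path:
  assumes "deterministic U" "halting_path U c \<rho>s" "length \<rho>s \<le> t"
  shows "(ustep U ^^ t) c = fold fire \<rho>s c"
  using assms(2,3)
proof (induction \<rho>s arbitrary: c t)
  case Nil
  then have "ustep U c = c"
    by (simp add: ustep_halted halting_path_def)
  then have "(ustep U ^^ t) c = c"
    by (induction t) auto
  then show ?case by simp
next
  case (Cons \<rho> \<rho>s)
  obtain t' where t: "t = Suc t'"
    using Cons.prems(2) by (cases t) auto
  have "halting_path U (fire \<rho> c) \<rho>s" "\<rho> \<in> enabled U c"
    using Cons.prems(1) by (auto simp: halting_path_def)
  then show ?case
    using Cons.IH[of "fire \<rho> c" t'] Cons.prems(2) ustep_enabled[OF assms(1)]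
    by (simp add: t funpow_Suc_right del: funpow.simps)
qed

section \<open>Expected payoff, split by the number of rounds\<close>

context simulator
begin

text \<open>The expected payoff on the event that exactly \<open>i\<close> further rounds are
  completed before the stop; the 1/2 in the base case is the probability of stopping.\<close>

fun stage :: "(bool list \<Rightarrow> nat \<Rightarrow> real) \<Rightarrow> nat \<Rightarrow> bool list \<Rightarrow> nat \<Rightarrow> real" where
  "stage V 0 \<pi> m = V \<pi> m / 2"
| "stage V (Suc i) \<pi> m =
     (\<Sum>\<chi>\<in>choices. case block \<chi> of None \<Rightarrow> 0 | Some bl \<Rightarrow> stage V i (\<pi> @ bl) (Suc m)) / 2 ^ (k + 2)"

lemma card_bool_lists: "card {xs :: bool list. length xs = n} = 2 ^ n"
  using card_lists_length_eq[of "UNIV :: bool set" n] by simp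

lemma card_choices: "card choices = 2 ^ (k + 2)"
  unfolding choices_def by (rule card_bool_lists)

lemma block_eq_None: "block \<chi> = None \<longleftrightarrow> \<chi> = [] \<or> hd \<chi> = False"
  by (induction \<chi> rule: block.induct) auto

lemma sum_stop: "(\<Sum>\<chi>\<in>choices. of_bool (block \<chi> = None)) = (2 ^ (k + 1) :: real)"
proof -
  have "{\<chi> \<in> choices. block \<chi> = None} = (#) False ` {xs. length xs = k + 1}"
    by (auto simp: choices_def block_eq_None length_Suc_conv)
  then have "card {\<chi> \<in> choices. block \<chi> = None} = 2 ^ (k + 1)"
    by (simp add: card_image card_bool_lists del: power_Suc)
  then show ?thesis
    using finite_choices by (simp add: of_bool_def sum.If_cases Int_def)
qed

lemma sum_continue: "(\<Sum>\<chi>\<in>choices. of_bool (block \<chi> \<noteq> None)) = (2 ^ (k + 1) :: real)"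
proof -
  have "(\<Sum>\<chi>\<in>choices. of_bool (block \<chi> = None) + of_bool (block \<chi> \<noteq> None)) = (\<Sum>\<chi>\<in>choices. 1 :: real)"
    by (intro sum.cong) auto
  then show ?thesis
    using sum_stop by (simp add: sum.distrib card_choices)
qed

lemma scan_value_finished: "scan_value V True \<pi> m l = 2 ^ ((k + 2) * l) * V \<pi> m"
  by (induction l) (simp_all add: card_choices power_add algebra_simps)

text \<open>The idle flips after a stop multiply the count by as much as the denominator, so
  dividing by the number of flip sequences leaves the expected payoff over all stops within
  \<open>l\<close> cells.\<close>

lemma scan_value_stage:
  "real (scan_value V False \<pi> m l) = 2 ^ ((k + 2) * l) * (\<Sum>i<l. stage (\<lambda>\<pi> m. real (V \<pi> m)) i \<pi> m)"
proof (induction l arbitrary: \<pi> m)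
  case (Suc l)
  let ?s = "stage (\<lambda>\<pi> m. real (V \<pi> m))" and ?c = "2 ^ ((k + 2) * l) :: real"
  have "real (scan_value V False \<pi> m (Suc l)) =
    (\<Sum>\<chi>\<in>choices. of_bool (block \<chi> = None) * (?c * V \<pi> m) +
      ?c * (\<Sum>i<l. case block \<chi> of None \<Rightarrow> 0 | Some bl \<Rightarrow> ?s i (\<pi> @ bl) (Suc m)))"
    by (simp add: Suc scan_value_finished split: option.splits)
      (auto intro!: sum.cong simp: Suc scan_value_finished split: option.splits)
  also have "\<dots> = 2 ^ (k + 1) * (?c * V \<pi> m) +
      ?c * (\<Sum>i<l. \<Sum>\<chi>\<in>choices. case block \<chi> of None \<Rightarrow> 0 | Some bl \<Rightarrow> ?s i (\<pi> @ bl) (Suc m))"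
    by (simp only: sum.distrib sum_distrib_right[symmetric] sum_stop sum_distrib_left[symmetric])
      (subst sum.swap, rule refl)
  also have "\<dots> = 2 ^ ((k + 2) * Suc l) * (?s 0 \<pi> m + (\<Sum>i<l. ?s (Suc i) \<pi> m))"
    by (simp add: power_add distrib_left sum_divide_distrib[symmetric])
  also have "\<dots> = 2 ^ ((k + 2) * Suc l) * (\<Sum>i<Suc l. ?s i \<pi> m)"
    by (subst sum.lessThan_Suc_shift) (rule refl)
  finally show ?case .
qed simp

lemma stage_nonneg:
  assumes "\<And>\<pi> m. 0 \<le> V \<pi> m"
  shows "0 \<le> stage V i \<pi> m"
  by (induction i arbitrary: \<pi> m) (auto intro!: sum_nonneg divide_nonneg_pos simp: assms split: option.split)

lemma stage_le:
  assumes "\<And>\<pi> m. V \<pi> m \<le> B"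
  shows "stage V i \<pi> m \<le> B / 2 ^ Suc i"
proof (induction i arbitrary: \<pi> m)
  case (Suc i)
  have "(\<Sum>\<chi>\<in>choices. case block \<chi> of None \<Rightarrow> 0 | Some bl \<Rightarrow> stage V i (\<pi> @ bl) (Suc m)) \<le>
    (\<Sum>\<chi>\<in>choices. of_bool (block \<chi> \<noteq> None) * (B / 2 ^ Suc i))"
    by (intro sum_mono) (use Suc in \<open>auto split: option.split\<close>)
  also have "\<dots> = 2 ^ (k + 1) * (B / 2 ^ Suc i)"
    by (simp only: sum_distrib_right[symmetric] sum_continue)
  finally show ?case
    by (simp add: field_simps)
qed (simp add: assms)

lemma stage_average:
  assumes "\<And>\<pi> m. V \<pi> m = (V0 \<pi> m + V1 \<pi> m) / 2"
  shows "stage V i \<pi> m = (stage V0 i \<pi> m + stage V1 i \<pi> m) / 2"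
proof (induction i arbitrary: \<pi> m)
  case (Suc i)
  have "(\<Sum>\<chi>\<in>choices. case block \<chi> of None \<Rightarrow> 0 | Some bl \<Rightarrow> stage V i (\<pi> @ bl) (Suc m)) =
    (\<Sum>\<chi>\<in>choices. ((case block \<chi> of None \<Rightarrow> 0 | Some bl \<Rightarrow> stage V0 i (\<pi> @ bl) (Suc m)) +
      (case block \<chi> of None \<Rightarrow> 0 | Some bl \<Rightarrow> stage V1 i (\<pi> @ bl) (Suc m))) / 2)"
    by (intro sum.cong) (auto simp: Suc split: option.split)
  then show ?case
    by (simp add: sum.distrib sum_divide_distrib[symmetric] add_divide_distrib)
qed (simp add: assms add_divide_distrib)

text \<open>Keeps a single branch. In the applications \<open>Y\<close> consists of the flip strings
  that begin with one code word of length \<open>c\<close>, an event of probability 2 to the power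
  -c.\<close>

lemma stage_ge:
  assumes "\<And>\<pi> m. 0 \<le> V \<pi> m" and Y: "Y \<subseteq> choices" "\<And>\<chi>. \<chi> \<in> Y \<Longrightarrow> block \<chi> = Some bl"
    and card: "card Y * 2 ^ c = 2 ^ (k + 2)"
  shows "stage V i (\<pi> @ bl) (Suc m) / 2 ^ c \<le> stage V (Suc i) \<pi> m"
proof -
  let ?f = "\<lambda>\<chi>. case block \<chi> of None \<Rightarrow> 0 | Some bl \<Rightarrow> stage V i (\<pi> @ bl) (Suc m)"
  have "real (card Y) * stage V i (\<pi> @ bl) (Suc m) = (\<Sum>\<chi>\<in>Y. ?f \<chi>)"
    using Y(2) by simp
  also have "\<dots> \<le> (\<Sum>\<chi>\<in>choices. ?f \<chi>)"
    by (rule sum_mono2[OF finite_choices Y(1)]) (auto simp: stage_nonneg assms(1) split: option.split)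
  finally have *: "real (card Y) * stage V i (\<pi> @ bl) (Suc m) / 2 ^ (k + 2) \<le> stage V (Suc i) \<pi> m"
    by (simp add: divide_right_mono del: power_Suc power_add)
  have "(2::real) ^ (k + 2) = real (card Y) * 2 ^ c"
    using card by (metis of_nat_mult of_nat_numeral of_nat_power)
  moreover from this have "real (card Y) \<noteq> 0"
    by (metis mult_zero_left power_not_zero zero_neq_numeral)
  ultimately have "real (card Y) * stage V i (\<pi> @ bl) (Suc m) / 2 ^ (k + 2) = stage V i (\<pi> @ bl) (Suc m) / 2 ^ c"
    by simp
  with * show ?thesis by simp
qed

lemma stage_ge_empty:
  assumes "\<And>\<pi> m. 0 \<le> V \<pi> m"
  shows "V \<pi> (m + n) / 2 ^ (3 * n + 1) \<le> stage V n \<pi> m"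
proof (induction n arbitrary: m)
  case (Suc n)
  let ?Y = "(\<lambda>xs. True # False # False # xs) ` {xs. length xs = k - 1}"
  have "stage V n (\<pi> @ []) (Suc m) / 2 ^ 3 \<le> stage V (Suc n) \<pi> m"
  proof (rule stage_ge[where Y = ?Y])
    have "card ?Y = 2 ^ (k - 1)"
      by (subst card_image) (auto simp: inj_on_def card_bool_lists)
    moreover have "k - 1 + 3 = k + 2"
      using k by simp
    ultimately show "card ?Y * 2 ^ 3 = 2 ^ (k + 2)"
      by (simp only: power_add[symmetric])
  qed (use assms k in \<open>auto simp: choices_def\<close>)
  moreover have "V \<pi> (Suc m + n) / 2 ^ (3 * n + 1) / 2 ^ 3 \<le> stage V n (\<pi> @ []) (Suc m) / 2 ^ 3"
    (is "?X \<le> _")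
    using Suc[of "Suc m"] by (intro divide_right_mono) auto
  ultimately have "?X \<le> stage V (Suc n) \<pi> m"
    by (rule order_trans[rotated])
  then show ?case
    by (simp add: power_add del: stage.simps)
qed simp

lemma stage_ge_single:
  assumes "\<And>\<pi> m. 0 \<le> V \<pi> m"
  shows "V (\<pi> @ bs) (m + length bs + n) / 2 ^ (4 * length bs + 3 * n + 1) \<le> stage V (length bs + n) \<pi> m"
proof (induction bs arbitrary: \<pi> m)
  case Nil
  then show ?case
    using stage_ge_empty[of V, OF assms] by simp
next
  case (Cons b bs)
  let ?Y = "(\<lambda>xs. True # False # True # b # xs) ` {xs. length xs = k - 2}"
  have "stage V (length bs + n) (\<pi> @ [b]) (Suc m) / 2 ^ 4 \<le> stage V (Suc (length bs + n)) \<pi> m"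
  proof (rule stage_ge[where Y = ?Y])
    have "card ?Y = 2 ^ (k - 2)"
      by (subst card_image) (auto simp: inj_on_def card_bool_lists)
    moreover have "k - 2 + 4 = k + 2"
      using k by simp
    ultimately show "card ?Y * 2 ^ 4 = 2 ^ (k + 2)"
      by (simp only: power_add[symmetric])
  qed (use assms k in \<open>auto simp: choices_def\<close>)
  moreover have "V ((\<pi> @ [b]) @ bs) (Suc m + length bs + n) / 2 ^ (4 * length bs + 3 * n + 1) / 2 ^ 4
      \<le> stage V (length bs + n) (\<pi> @ [b]) (Suc m) / 2 ^ 4"
    (is "?X \<le> _")
    using Cons[of "\<pi> @ [b]" "Suc m"] by (intro divide_right_mono) auto
  ultimately have "?X \<le> stage V (Suc (length bs + n)) \<pi> m"
    by (rule order_trans[rotated])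
  then show ?case
    by (simp add: power_add mult_ac del: stage.simps)
qed

text \<open>The exponent adds up code lengths: \<open>k + 2\<close> flips for each full block, 4 for
  each bit written singly, 3 for each idle round, 1 for the stop.\<close>

lemma stage_ge_full:
  assumes "\<And>\<pi> m. 0 \<le> V \<pi> m" "length bl = k * a"
  shows "V (\<pi> @ bl @ bs) (m + a + length bs + n) / 2 ^ ((k + 2) * a + 4 * length bs + 3 * n + 1)
    \<le> stage V (a + length bs + n) \<pi> m"
  using assms(2)
proof (induction a arbitrary: \<pi> m bl)
  case 0
  then show ?case
    using stage_ge_single[of V, OF assms(1)] by simp
next
  case (Suc a)
  let ?b = "take k bl" and ?bl = "drop k bl"
  have len: "length ?b = k" "length ?bl = k * a"
    using Suc.prems by auto
  have "stage V (a + length bs + n) (\<pi> @ ?b) (Suc m) / 2 ^ (k + 2) \<le> stage V (Suc (a + length bs + n)) \<pi> m"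
    by (rule stage_ge[where Y = "{True # True # ?b}"]) (use assms(1) len in \<open>auto simp: choices_def\<close>)
  moreover have "V ((\<pi> @ ?b) @ ?bl @ bs) (Suc m + a + length bs + n) /
      2 ^ ((k + 2) * a + 4 * length bs + 3 * n + 1) / 2 ^ (k + 2)
      \<le> stage V (a + length bs + n) (\<pi> @ ?b) (Suc m) / 2 ^ (k + 2)"
    (is "?X \<le> _")
    using Suc.IH[OF len(2), of "\<pi> @ ?b" "Suc m"] by (intro divide_right_mono) auto
  ultimately have "?X \<le> stage V (Suc (a + length bs + n)) \<pi> m"
    by (rule order_trans[rotated])
  moreover have "take k bl @ drop k bl @ bs = bl @ bs"
    by (metis append_assoc append_take_drop_id)
  ultimately show ?case
    by (simp add: power_add mult_ac del: stage.simps)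
qed

end

section \<open>The martingale, its approximation and its lower bound\<close>

context simulator
begin

lemma payoff_le: "payoff \<pi> m w \<le> 2 ^ length w"
proof -
  have "payoff \<pi> m w \<le> (\<Prod>i<length w. 2)"
    unfolding payoff_def by (intro prod_mono) (auto simp: agreement_def)
  then show ?thesis by simp
qed

lemma payoff_snoc: "payoff \<pi> m (w @ [a]) = payoff \<pi> m w * agreement (out_tape \<pi> m (int (length w))) a"
proof -
  have "(\<Prod>i<length w. agreement (out_tape \<pi> m (int i)) ((w @ [a]) ! i)) = payoff \<pi> m w"
    unfolding payoff_def by (intro prod.cong) (auto simp: nth_append)
  then show ?thesis
    by (simp add: payoff_def)
qed

text \<open>Whatever the next output symbol is, its agreements with the two bits sum to 2. The coin
  for cells without a bit is what makes this an equality.\<close>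

lemma payoff_average:
  "real (payoff \<pi> m w) = (real (payoff \<pi> m (w @ [False])) + real (payoff \<pi> m (w @ [True]))) / 2"
proof -
  have "agreement s False + agreement s True = 2" for s
    by (cases s) (auto simp: agreement_def)
  from arg_cong[OF this, of real] show ?thesis
    by (simp add: payoff_snoc flip: distrib_left)
qed

lemma payoff_printed:
  assumes "prints U \<pi> x t" "t < (m + 2) ^ j"
  shows "payoff \<pi> m x = 2 ^ length x"
proof -
  obtain \<rho>s where \<rho>s: "halting_path U (initial U \<pi>) \<rho>s" "length \<rho>s \<le> t"
    and out: "tape_shows (last (snd (fold fire \<rho>s (initial U \<pi>)))) x"
    using assms(1) by (auto simp: prints_def)
  \<comment> \<open>The clock grants \<open>(m + 2) ^ j - 1\<close> steps, hence the strict bound on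
    \<open>t\<close>.\<close>
  have "length \<rho>s \<le> (m + 2) ^ j - 1"
    using \<rho>s(2) assms(2) by linarith
  from ustep_halting_path[OF det \<rho>s(1) this]
  have "out_tape \<pi> m (int i) = Bit (x ! i)" if "i < length x" for i
    using out that unfolding out_tape_def tape_shows_def by simp
  then have "payoff \<pi> m x = (\<Prod>i<length x. 2)"
    unfolding payoff_def by (intro prod.cong) (auto simp: agreement_def)
  then show ?thesis by simp
qed

abbreviation summand :: "nat \<Rightarrow> bool list \<Rightarrow> real" where
  "summand i w \<equiv> stage (\<lambda>\<pi> m. real (payoff \<pi> m w)) i [] 0"

definition capital :: "bool list \<Rightarrow> real" where
  "capital w = (\<Sum>i. summand i w)"

lemma term_bounds: "0 \<le> summand i w" "summand i w \<le> 2 ^ length w * (1 / 2) ^ Suc i"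
proof -
  show "0 \<le> summand i w"
    by (rule stage_nonneg) simp
  have "summand i w \<le> 2 ^ length w / 2 ^ Suc i"
  proof (rule stage_le)
    show "real (payoff \<pi> m w) \<le> 2 ^ length w" for \<pi> m
      using payoff_le[of \<pi> m w] by (metis of_nat_le_iff of_nat_numeral of_nat_power)
  qed
  then show "summand i w \<le> 2 ^ length w * (1 / 2) ^ Suc i"
    by (simp add: power_one_over field_simps)
qed

lemma sums_half: "(\<lambda>i. c * (1 / 2 :: real) ^ Suc i) sums c"
  using sums_mult[OF power_half_series, of c] by simp

lemma summable_term: "summable (\<lambda>i. summand i w)"
  by (rule summable_comparison_test'[OF sums_summable[OF sums_half], of 0])
    (use term_bounds[where w = w] in \<open>auto simp del: power_Suc\<close>)

lemma martingale_capital: "martingale capital"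
  unfolding martingale_def
proof (intro allI conjI)
  fix w
  show "0 \<le> capital w"
    unfolding capital_def by (intro suminf_nonneg summable_term term_bounds)
  have "summand i w = (summand i (w @ [False]) + summand i (w @ [True])) / 2" for i
    by (rule stage_average) (rule payoff_average)
  then have "capital w = (\<Sum>i. (summand i (w @ [False]) + summand i (w @ [True])) / 2)"
    unfolding capital_def by (intro suminf_cong)
  also have "\<dots> = (capital (w @ [False]) + capital (w @ [True])) / 2"
    unfolding capital_def
    by (subst suminf_divide) (auto intro!: summable_add summable_term simp: suminf_add[OF summable_term summable_term, symmetric])
  finally show "capital w = (capital (w @ [False]) + capital (w @ [True])) / 2" .
qed

lemma capital_approx: "\<bar>capital w - (\<Sum>i<l. summand i w)\<bar> \<le> 2 ^ length w / 2 ^ l"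
proof -
  have "capital w - (\<Sum>i<l. summand i w) = (\<Sum>i. summand (i + l) w)"
    using suminf_split_initial_segment[OF summable_term, of w l] by (simp add: capital_def)
  moreover have "0 \<le> (\<Sum>i. summand (i + l) w)"
    by (intro suminf_nonneg summable_ignore_initial_segment[OF summable_term] term_bounds)
  moreover have "(\<Sum>i. summand (i + l) w) \<le> 2 ^ length w / 2 ^ l"
  proof -
    have "(\<Sum>i. summand (i + l) w) \<le> (\<Sum>i. (2 ^ length w / 2 ^ l) * (1 / 2) ^ Suc i)"
    proof (intro suminf_le summable_ignore_initial_segment[OF summable_term] sums_summable[OF sums_half])
      fix i
      have "summand (i + l) w \<le> 2 ^ length w * (1 / 2) ^ Suc (i + l)"
        by (rule term_bounds)
      also have "\<dots> = (2 ^ length w / 2 ^ l) * (1 / 2) ^ Suc i"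
        by (simp add: power_add power_one_over)
      finally show "summand (i + l) w \<le> (2 ^ length w / 2 ^ l) * (1 / 2) ^ Suc i" .
    qed
    then show ?thesis
      by (simp only: sums_unique[OF sums_half, symmetric])
  qed
  ultimately show ?thesis by simp
qed

lemma sharpP_martingale_capital: "sharpP_martingale capital"
proof -
  have "polytime_computable (\<lambda>x. 2 ^ ((k + 2) * length x))"
    by (intro power_printer.polytime_power power_printer.intro) simp
  moreover  have "\<bar>capital w - real (path_total (enc w r)) / real (2 ^ ((k + 2) * length (enc w r)))\<bar> \<le> 1 / 2 ^ r" for w r
  proof -
    let ?L = "length (enc w r)"
    have "real (path_total (enc w r)) / real (2 ^ ((k + 2) * ?L)) = (\<Sum>i<?L. summand i w)"
      unfolding path_total_enc scan_value_stage by (simp del: mult_Suc add_2_eq_Suc')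
    then have "\<bar>capital w - real (path_total (enc w r)) / real (2 ^ ((k + 2) * ?L))\<bar> \<le> 2 ^ length w / 2 ^ ?L"
      using capital_approx[of w ?L] by simp
    \<comment> \<open>The cells of \<open>w\<close> in the code cancel the factor
      \<open>2 ^ length w\<close>, and the ones in front provide the accuracy.\<close>
    also have "\<dots> = 1 / 2 ^ r / 2"
      by (simp add: enc_def power_add)
    also have "\<dots> \<le> 1 / 2 ^ r"
      by (simp add: field_simps)
    finally show ?thesis .
  qed
  ultimately show ?thesis
    unfolding sharpP_martingale_def
    using martingale_capital sharpP_path_total
    by (intro conjI exI[of _ path_total] exI[of _ "\<lambda>x. 2 ^ ((k + 2) * length x)"]) auto
qed

text \<open>One stage of the series suffices: full blocks for all but the last
  \<open>length \<pi> mod k\<close> bits, these singly, then \<open>n\<close> idle rounds. All these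
  rounds count towards \<open>m\<close>.\<close>

lemma capital_ge:
  assumes "prints U \<pi> x t" "t < (length \<pi> div k + length \<pi> mod k + n + 2) ^ j"
  shows "2 ^ length x / 2 ^ ((k + 2) * (length \<pi> div k) + 4 * (length \<pi> mod k) + 3 * n + 1) \<le> capital x"
proof -
  let ?a = "length \<pi> div k"
  let ?bl = "take (k * ?a) \<pi>" and ?bs = "drop (k * ?a) \<pi>"
  have len: "length ?bl = k * ?a" "length ?bs = length \<pi> mod k"
    by (auto simp: minus_mult_div_eq_mod)
  have "real (payoff ([] @ ?bl @ ?bs) (0 + ?a + length ?bs + n) x) / 2 ^ ((k + 2) * ?a + 4 * length ?bs + 3 * n + 1)
    \<le> summand (?a + length ?bs + n) x"
    by (rule stage_ge_full) (use len in auto)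
  also have "\<dots> = (\<Sum>i\<in>{?a + length ?bs + n}. summand i x)"
    by simp
  also have "\<dots> \<le> capital x"
    unfolding capital_def by (intro sum_le_suminf summable_term) (auto simp: term_bounds)
  finally have "real (payoff \<pi> (?a + length \<pi> mod k + n) x) /
      2 ^ ((k + 2) * ?a + 4 * (length \<pi> mod k) + 3 * n + 1) \<le> capital x"
    unfolding len(2) by simp
  then show ?thesis
    using payoff_printed[OF assms(1), of "?a + length \<pi> mod k + n"] assms(2) by simp
qed

end

lemma exists_sharpP_martingale:
  fixes p :: "nat poly" and s e :: real
  assumes "universal U" "0 \<le> s" "0 < e"
  obtains d n0 where "sharpP_martingale d"
    "\<And>x \<pi>. \<lbrakk>n0 \<le> length x; prints U \<pi> x (poly p (length x)); real (length \<pi>) \<le> s * length x\<rbrakk> \<Longrightarrow>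
       2 powr ((1 - (s + e)) * length x) \<le> d x"
proof -
  \<comment> \<open>Block headers cost about 2s/k flips per output bit and idle rounds 3/k; this
    \<open>k\<close> keeps their sum below e/2.\<close>
  define k where "k = max 2 (nat \<lceil>2 * (2 * s + 3) / e\<rceil>)"
  have k2: "2 \<le> k" by (simp add: k_def)
  have "2 * (2 * s + 3) / e \<le> real k"
    unfolding k_def by linarith
  then have ke: "2 * s + 3 \<le> e / 2 * real k"
    using assms(3) by (simp add: field_simps)
  obtain j where j: "\<And>m n. n \<le> k * m \<Longrightarrow> poly p n < (m + 2) ^ j"
    using poly_le_power[of k p] by blast
  interpret simulator U k j
    using assms(1) k2 by unfold_locales (auto simp: universal_def)
  \<comment> \<open>The other half of \<open>e\<close> absorbs the constant cost: 4 flips for each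
    of at most \<open>k\<close> leftover bits, 3 for rounding up the number of idle rounds, and 1
    for the stop.\<close>
  define n0 where "n0 = nat \<lceil>2 * (4 * real k + 4) / e\<rceil>"
  show ?thesis
  proof (rule that[OF sharpP_martingale_capital])
    fix x \<pi>
    assume n0: "n0 \<le> length x" and pr: "prints U \<pi> x (poly p (length x))" and l: "real (length \<pi>) \<le> s * length x"
    \<comment> \<open>The \<open>?c\<close> idle rounds alone give \<open>k * ?c \<ge> ?n\<close>,
      so the clock lasts long enough however short the program is.\<close>
    let ?n = "length x"
    let ?a = "length \<pi> div k" and ?b = "length \<pi> mod k" and ?c = "?n div k + 1"
    have "?n \<le> k * ?c"
      using k2 dividend_less_times_div[of k ?n] by (simp add: algebra_simps)
    also have "\<dots> \<le> k * (?a + ?b + ?c)"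
      by simp
    finally have "poly p ?n < (?a + ?b + ?c + 2) ^ j"
      by (rule j)
    from capital_ge[OF pr this]
    have ge: "2 ^ ?n / 2 ^ ((k + 2) * ?a + 4 * ?b + 3 * ?c + 1) \<le> capital x" .
    have kpos: "0 < real k" using k2 by simp
    have "real ?b \<le> real k"
      using k2 by (simp add: less_imp_le)
    moreover have "real ?a * real k + real ?b = real (length \<pi>)"
      by (metis div_mult_mod_eq of_nat_add of_nat_mult)
    moreover have "real ?a \<le> s * ?n / k"
      using l of_nat_div_le_of_nat[of "length \<pi>" k] kpos by (smt (verit) divide_right_mono)
    moreover have "real (?n div k) \<le> ?n / k"
      by (rule of_nat_div_le_of_nat)
    moreover have "(2 * s + 3) * (?n / k) \<le> e / 2 * ?n"
    proof -
      have "(2 * s + 3) * (?n / k) \<le> (e / 2 * k) * (?n / k)"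
        by (intro mult_right_mono ke) simp
      then show ?thesis
        using kpos by simp
    qed
    then have "2 * (s * ?n / k) + 3 * (?n / k) \<le> e / 2 * ?n"
      by (simp add: algebra_simps)
    moreover have "4 * real k + 4 \<le> e / 2 * ?n"
    proof -
      have "2 * (4 * real k + 4) / e \<le> real ?n"
        using n0 unfolding n0_def by linarith
      then show ?thesis
        using assms(3) by (simp add: field_simps)
    qed
    moreover have "real ((k + 2) * ?a + 4 * ?b + 3 * ?c + 1) =
      real ?a * real k + 2 * real ?a + 4 * real ?b + 3 * real (?n div k) + 4"
      by (simp add: algebra_simps)
    ultimately have "real ((k + 2) * ?a + 4 * ?b + 3 * ?c + 1) \<le> s * ?n + e * ?n"
      using l by linarith
    then have "(1 - (s + e)) * ?n \<le> real ?n - real ((k + 2) * ?a + 4 * ?b + 3 * ?c + 1)"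
      by (simp add: algebra_simps)
    then have "2 powr ((1 - (s + e)) * ?n) \<le> 2 powr (real ?n - real ((k + 2) * ?a + 4 * ?b + 3 * ?c + 1))"
      by simp
    also have "\<dots> = 2 ^ ?n / 2 ^ ((k + 2) * ?a + 4 * ?b + 3 * ?c + 1)"
      unfolding powr_diff by (simp only: powr_realpow zero_less_numeral)
    finally show "2 powr ((1 - (s + e)) * ?n) \<le> capital x"
      using ge by linarith
  qed
qed

section \<open>From time-bounded complexity to dimension\<close>

lemma program_of_K_less:
  fixes s :: real
  assumes "ennreal_of_enat (K U t x) / of_nat (length x) < ennreal s" "0 < length x" "0 \<le> s"
  obtains \<pi> where "prints U \<pi> x (t (length x))" "real (length \<pi>) \<le> s * length x"
proof -
  have "K U t x \<noteq> \<infinity>"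
    using assms(1,2) by (cases "K U t x") (auto simp: ennreal_top_divide)
  then have "{\<pi>. prints U \<pi> x (t (length x))} \<noteq> {}"
    unfolding K_def by (metis Inf_empty image_empty top_enat_def)
  \<comment> \<open>An infimum of a nonempty set in \<open>enat\<close> is attained.\<close>
  then have "K U t x \<in> (\<lambda>\<pi>. enat (length \<pi>)) ` {\<pi>. prints U \<pi> x (t (length x))}"
    unfolding K_def by (metis (no_types, lifting) Inf_enat_def LeastI_ex ex_in_conv image_is_empty)
  then obtain \<pi> where \<pi>: "prints U \<pi> x (t (length x))" "K U t x = enat (length \<pi>)"
    by auto
  have "ennreal (length \<pi> / length x) < ennreal s"
    using assms(1,2) \<pi>(2) by (simp add: ennreal_of_nat_eq_real_of_nat divide_ennreal)
  then have "length \<pi> / length x < s"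
    using assms(3) by (simp add: ennreal_less_iff)
  then have "real (length \<pi>) \<le> s * length x"
    using assms(2) by (simp add: field_simps)
  with \<pi>(1) that show ?thesis by blast
qed

lemma less_add_ennreal: "y < top \<Longrightarrow> 0 < e \<Longrightarrow> y < y + ennreal e"
  by (cases y) (auto simp: ennreal_less_iff simp flip: ennreal_plus)

lemma length_prefix [simp]: "length (S \<restriction> n) = n"
  by (simp add: prefix_def)

text \<open>Both bounds come from the same construction: for given \<open>y\<close> and
  \<open>e\<close>, a single martingale wins at every large \<open>n\<close> with
  \<open>\<kappa> S n < y + e/2\<close>. A limes inferior below that threshold provides infinitely
  many such \<open>n\<close>, a limes superior all but finitely many. Half of \<open>e\<close> makes
  the comparison with the supremum strict, the other half pays for the martingale.\<close>

lemma dimension_bounds: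
  fixes p :: "nat poly" and X :: "(nat \<Rightarrow> bool) set"
  assumes "universal U"
  defines "\<kappa> \<equiv> \<lambda>S n. ennreal_of_enat (K U (poly p) (S \<restriction> n)) / of_nat n"
  shows "dim_sharpP X \<le> (SUP S\<in>X. liminf (\<kappa> S))" and "Dim_sharpP X \<le> (SUP S\<in>X. limsup (\<kappa> S))"
proof -
  have *: "\<exists>s d. 0 < s \<and> ennreal s \<le> y + ennreal e \<and> sharpP_martingale d \<and>
      (\<forall>S. \<exists>n0. \<forall>n\<ge>n0. \<kappa> S n < y + ennreal (e / 2) \<longrightarrow> 2 powr ((1 - s) * n) \<le> d (S \<restriction> n))"
    if y_top: "y < top" and "0 < e" for y e
  proof -
    obtain u where u: "y = ennreal u" "0 \<le> u"
      using y_top by (cases y) auto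
    let ?s = "u + e / 2"
    have y: "y + ennreal (e / 2) = ennreal ?s" "y + ennreal e = ennreal (?s + e / 2)"
      using u that(2) by (simp_all flip: ennreal_plus)
    have nn: "0 \<le> ?s" "0 < e / 2"
      using u that(2) by simp_all
    obtain d n0 where d: "sharpP_martingale d"
      and win: "\<And>x \<pi>. \<lbrakk>n0 \<le> length x; prints U \<pi> x (poly p (length x)); real (length \<pi>) \<le> ?s * length x\<rbrakk> \<Longrightarrow>
         2 powr ((1 - (?s + e / 2)) * length x) \<le> d x"
      using exists_sharpP_martingale[OF assms(1) nn] by blast
    have "2 powr ((1 - (?s + e / 2)) * n) \<le> d (S \<restriction> n)"
      \<comment> \<open>The empty prefix is excluded because there the ratio is a division by
        zero.\<close>
      if n: "max 1 n0 \<le> n" and less: "\<kappa> S n < ennreal ?s" for S n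
    proof -
      obtain \<pi> where "prints U \<pi> (S \<restriction> n) (poly p n)" "real (length \<pi>) \<le> ?s * n"
        using program_of_K_less[of U "poly p" "S \<restriction> n" ?s] less n nn(1) unfolding \<kappa>_def by auto
      then show ?thesis
        using win[of "S \<restriction> n" \<pi>] n by simp
    qed
    then have "\<exists>n0. \<forall>n\<ge>n0. \<kappa> S n < ennreal ?s \<longrightarrow> 2 powr ((1 - (?s + e / 2)) * n) \<le> d (S \<restriction> n)" for S
      by blast
    then show ?thesis
      unfolding y using d nn by (intro exI[of _ "?s + e / 2"] exI[of _ d]) (simp add: add_nonneg_pos)
  qed
  show "dim_sharpP X \<le> (SUP S\<in>X. liminf (\<kappa> S))"
  proof (rule ennreal_le_epsilon)
    fix e :: real
    let ?y = "SUP S\<in>X. liminf (\<kappa> S)"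
    assume e: "?y < top" "0 < e"
    obtain s d where sd: "0 < s" "ennreal s \<le> ?y + ennreal e" "sharpP_martingale d"
      and win: "\<And>S. \<exists>n0. \<forall>n\<ge>n0. \<kappa> S n < ?y + ennreal (e / 2) \<longrightarrow> 2 powr ((1 - s) * n) \<le> d (S \<restriction> n)"
      using *[OF e] by blast
    have "succeeds s d S" if "S \<in> X" for S
    proof -
      have "liminf (\<kappa> S) \<le> ?y"
        by (rule SUP_upper[OF that])
      also have "?y < ?y + ennreal (e / 2)"
        using e by (intro less_add_ennreal) auto
      finally have "liminf (\<kappa> S) < ?y + ennreal (e / 2)" .
      then have "\<exists>\<^sub>F n in sequentially. \<kappa> S n < ?y + ennreal (e / 2)"
        using Liminf_bounded[of "?y + ennreal (e / 2)" "\<kappa> S" sequentially]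
        unfolding frequently_def not_less by (meson leD)
      moreover have "\<forall>\<^sub>F n in sequentially. \<kappa> S n < ?y + ennreal (e / 2) \<longrightarrow> 2 powr ((1 - s) * n) \<le> d (S \<restriction> n)"
        using win[of S] unfolding eventually_sequentially .
      ultimately show ?thesis
        unfolding succeeds_def by (rule frequently_rev_mp)
    qed
    then have "dim_sharpP X \<le> ennreal s"
      unfolding dim_sharpP_def using sd by (intro INF_lower) auto
    with sd(2) show "dim_sharpP X \<le> ?y + ennreal e"
      by (rule order_trans[rotated])
  qed
  show "Dim_sharpP X \<le> (SUP S\<in>X. limsup (\<kappa> S))"
  proof (rule ennreal_le_epsilon)
    fix e :: real
    let ?y = "SUP S\<in>X. limsup (\<kappa> S)"
    assume e: "?y < top" "0 < e"
    obtain s d where sd: "0 < s" "ennreal s \<le> ?y + ennreal e" "sharpP_martingale d"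
      and win: "\<And>S. \<exists>n0. \<forall>n\<ge>n0. \<kappa> S n < ?y + ennreal (e / 2) \<longrightarrow> 2 powr ((1 - s) * n) \<le> d (S \<restriction> n)"
      using *[OF e] by blast
    have "strongly_succeeds s d S" if "S \<in> X" for S
    proof -
      have "limsup (\<kappa> S) \<le> ?y"
        by (rule SUP_upper[OF that])
      also have "?y < ?y + ennreal (e / 2)"
        using e by (intro less_add_ennreal) auto
      finally have "limsup (\<kappa> S) < ?y + ennreal (e / 2)" .
      then have "\<forall>\<^sub>F n in sequentially. \<kappa> S n < ?y + ennreal (e / 2)"
        by (rule Limsup_lessD)
      moreover have "\<forall>\<^sub>F n in sequentially. \<kappa> S n < ?y + ennreal (e / 2) \<longrightarrow> 2 powr ((1 - s) * n) \<le> d (S \<restriction> n)"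
        using win[of S] unfolding eventually_sequentially .
      ultimately show ?thesis
        unfolding strongly_succeeds_def by (rule eventually_rev_mp)
    qed
    then have "Dim_sharpP X \<le> ennreal s"
      unfolding Dim_sharpP_def using sd by (intro INF_lower) auto
    with sd(2) show "Dim_sharpP X \<le> ?y + ennreal e"
      by (rule order_trans[rotated])
  qed
qed

theorem mainTheorem17:
  fixes U :: tm and X :: "(nat \<Rightarrow> bool) set"
  assumes "universal U"
  shows "dim_sharpP X \<le> K_poly U X \<and> Dim_sharpP X \<le> K_str_poly U X"
  unfolding K_poly_def K_str_poly_def using dimension_bounds[OF assms] by (auto intro!: INF_greatest)

end
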